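(* Let $(X,\rho,\mu)$ be a space of homogeneous type with quasi-triangle constant $\kappa$. Then $\mathscr{A}_\infty^\sigma = A_\infty^\sigma = \mathscr{A}_\infty^{\sigma'}$ for every $\sigma, \sigma' > \kappa$.
   Context: A space of homogeneous type $(X,\rho,\mu)$: $\rho$ is a quasi-metric, i.e. it satisfies the axioms of a metric except that the triangle inequality is replaced by $\rho(x,y)\le \kappa(\rho(x,z)+\rho(z,y))$ for some $\kappa\ge 1$; $\mu$ is a Borel measure with $0<\mu(B)<\infty$ for balls $B$ and $\mu(B(x,2r))\le D\mu(B(x,r))$ for every ball $B(x,r)=\{y: \rho(x,y)<r\}$. All balls are assumed to be Borel sets. For $B=B(x,r)$, $\lambda B = B(x,\lambda r)$. A weight is a nonnegative measurable function $w$ on $X$; $w(E)=\int_E w\,d\mu$. Let $Mf(x)=\sup_{B\ni x}\frac{1}{\mu(B)}\int_B |f|\,d\mu$ (supremum over balls containing $x$). For $\sigma\ge1$, $A_\infty^\sigma$ is the class of weights with $\sup_B \frac{1}{w(\sigma B)}\int_B M(1_B w)\,d\mu<\infty$, i.e. there is a finite $C$ with $\int_B M(1_Bw)\,d\mu\le C\,w(\sigma B)$ for all balls $B$. For $\sigma\ge 1$, $\mathscr{A}_\infty^\sigma$ is the class of weights $w$ for which there exist constants $C>0$ and $p\ge1$ such that for every ball $B$ and every measurable set $E\subseteq B$, $\frac{w(E)}{w(\sigma B)}\le C\left(\frac{\mu(E)}{\mu(B)}\right)^{1/p}$ (read as $w(E)\le C(\mu(E)/\mu(B))^{1/p}w(\sigma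 B)$). *)

theory Defs
  imports "HOL-Analysis.Analysis"
begin

definition qball :: "'a set \<Rightarrow> ('a \<Rightarrow> 'a \<Rightarrow> real) \<Rightarrow> 'a \<Rightarrow> real \<Rightarrow> 'a set"
  where "qball X \<rho> x r = {y \<in> X. \<rho> x y < r}"

text \<open>The topology of a quasi-metric. Balls need not be open in it.\<close>

definition qopen :: "'a set \<Rightarrow> ('a \<Rightarrow> 'a \<Rightarrow> real) \<Rightarrow> 'a set \<Rightarrow> bool"
  where "qopen X \<rho> U \<longleftrightarrow> U \<subseteq> X \<and> (\<forall>x\<in>U. \<exists>r>0. qball X \<rho> x r \<subseteq> U)"

locale quasi_metric_space =
  fixes X :: "'a set" and \<rho> :: "'a \<Rightarrow> 'a \<Rightarrow> real" and \<kappa> :: real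
  assumes \<kappa>_ge_1: "\<kappa> \<ge> 1"
    and nonneg: "\<lbrakk>x \<in> X; y \<in> X\<rbrakk> \<Longrightarrow> 0 \<le> \<rho> x y"
    and zero: "\<lbrakk>x \<in> X; y \<in> X\<rbrakk> \<Longrightarrow> \<rho> x y = 0 \<longleftrightarrow> x = y"
    and commute: "\<lbrakk>x \<in> X; y \<in> X\<rbrakk> \<Longrightarrow> \<rho> x y = \<rho> y x"
    and quasi_triangle:
      "\<lbrakk>x \<in> X; y \<in> X; z \<in> X\<rbrakk> \<Longrightarrow> \<rho> x y \<le> \<kappa> * (\<rho> x z + \<rho> z y)"

locale homogeneous_type_space = quasi_metric_space X \<rho> \<kappa>
  for X :: "'a set" and \<rho> :: "'a \<Rightarrow> 'a \<Rightarrow> real" and \<kappa> :: real +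
  fixes \<mu> :: "'a measure" and D :: real
  assumes space_eq: "space \<mu> = X"
    and sets_eq: "sets \<mu> = sigma_sets X {U. qopen X \<rho> U}"
    and qball_sets: "\<lbrakk>x \<in> X; r > 0\<rbrakk> \<Longrightarrow> qball X \<rho> x r \<in> sets \<mu>"
    and qball_pos: "\<lbrakk>x \<in> X; r > 0\<rbrakk> \<Longrightarrow> 0 < emeasure \<mu> (qball X \<rho> x r)"
    and qball_finite: "\<lbrakk>x \<in> X; r > 0\<rbrakk> \<Longrightarrow> emeasure \<mu> (qball X \<rho> x r) < \<infinity>"
    and doubling: "\<lbrakk>x \<in> X; r > 0\<rbrakk> \<Longrightarrow>
      emeasure \<mu> (qball X \<rho> x (2 * r)) \<le> ennreal D * emeasure \<mu> (qball X \<rho> x r)"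

text \<open>Weights are not assumed to be locally integrable, so \<open>weight_of\<close> may be infinite on balls.\<close>

definition weight :: "'a set \<Rightarrow> 'a measure \<Rightarrow> ('a \<Rightarrow> real) \<Rightarrow> bool"
  where "weight X \<mu> w \<longleftrightarrow> w \<in> borel_measurable \<mu> \<and> (\<forall>x\<in>X. 0 \<le> w x)"

definition weight_of :: "'a measure \<Rightarrow> ('a \<Rightarrow> real) \<Rightarrow> 'a set \<Rightarrow> ennreal"
  where "weight_of \<mu> w E = (\<integral>\<^sup>+x\<in>E. ennreal (w x) \<partial>\<mu>)"

definition maximal ::
    "'a set \<Rightarrow> ('a \<Rightarrow> 'a \<Rightarrow> real) \<Rightarrow> 'a measure \<Rightarrow> ('a \<Rightarrow> real) \<Rightarrow> 'a \<Rightarrow> ennreal"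
  where "maximal X \<rho> \<mu> f x =
    (SUP (z, r) \<in> {(z, r). z \<in> X \<and> 0 < r \<and> x \<in> qball X \<rho> z r}.
      (\<integral>\<^sup>+y\<in>qball X \<rho> z r. ennreal \<bar>f y\<bar> \<partial>\<mu>) / emeasure \<mu> (qball X \<rho> z r))"

text \<open>
  In both classes a ball is given by a centre and a radius, since its dilate depends on these
  and not only on the underlying set. As balls need not be open, the maximal function need not
  be measurable; the integral of it below is then the lower integral. This does not affect the
  class, because the maximal function is bounded above and below by constant multiples of a
  measurable one, namely that of an equivalent quasi-metric with open balls.
\<close>

definition A_inf ::
    "'a set \<Rightarrow> ('a \<Rightarrow> 'a \<Rightarrow> real) \<Rightarrow> 'a measure \<Rightarrow> real \<Rightarrow> ('a \<Rightarrow> real) set"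
  where "A_inf X \<rho> \<mu> \<sigma> = {w. weight X \<mu> w \<and>
    (\<exists>C::real. C \<ge> 0 \<and> (\<forall>x\<in>X. \<forall>r>0.
      (\<integral>\<^sup>+y\<in>qball X \<rho> x r. maximal X \<rho> \<mu> (\<lambda>z. indicator (qball X \<rho> x r) z * w z) y \<partial>\<mu>)
        \<le> ennreal C * weight_of \<mu> w (qball X \<rho> x (\<sigma> * r))))}"

definition script_A_inf ::
    "'a set \<Rightarrow> ('a \<Rightarrow> 'a \<Rightarrow> real) \<Rightarrow> 'a measure \<Rightarrow> real \<Rightarrow> ('a \<Rightarrow> real) set"
  where "script_A_inf X \<rho> \<mu> \<sigma> = {w. weight X \<mu> w \<and>
    (\<exists>(C::real) (p::real). C > 0 \<and> p \<ge> 1 \<and> (\<forall>x\<in>X. \<forall>r>0. \<forall>E\<in>sets \<mu>. E \<subseteq> qball X \<rho> x r \<longrightarrow>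
      weight_of \<mu> w E
        \<le> ennreal (C * (measure \<mu> E / measure \<mu> (qball X \<rho> x r)) powr (1 / p))
          * weight_of \<mu> w (qball X \<rho> x (\<sigma> * r))))}"

end

theory Submission
  imports Defs
begin

text \<open>
  Let \<open>\<nu>\<close> be the measure with density \<open>w\<close>. A finite covering by small balls shows that the class
  of the power condition is the same for all dilation factors above \<open>\<kappa>\<close>. It
  implies the maximal function condition by integrating the weak type inequality over dyadic levels: the
  measure of \<open>M (1\<^sub>B w) > 2 q\<close> is at most a constant multiple of \<open>\<nu> (B \<inter> {w > q}) / q\<close>, and the power
  condition makes this geometrically small relative to \<open>\<nu> (\<sigma> B) / q\<close>.

  Conversely, consider the disjoint balls, as large as possible up to a factor, on which \<open>w\<close> has average
  above \<open>2\<^sup>n\<close> times its average over a ball \<open>B\<close>. Integrability of the maximal function shows that their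
  union carries at most a fraction of order \<open>1 / n\<close> of the weight of a fixed dilate of \<open>B\<close>. Applying this again
  inside the dilates of these balls yields a geometric decay \<open>2\<^sup>-\<^sup>n\<close> at level \<open>\<Lambda>\<^sup>n\<close>.
  For \<open>E \<subseteq> B\<close> this gives \<open>\<nu> E \<le> (2\<^sup>-\<^sup>n + C \<Lambda>\<^sup>n \<mu> E / \<mu> B) \<nu> (\<tau> B)\<close> for all \<open>n\<close>, with \<open>\<tau> = 2 \<kappa> \<sigma>\<close>,
  and the optimal \<open>n\<close> gives the power condition.
\<close>

text \<open>Balls need not be open, so the proof makes no claim that a maximal function, its level
  sets or an uncountable union of balls is measurable. Lower integrals are bounded below by finite
  sums of indicators and above by measurable majorants, and unions of balls are replaced by
  countable unions of dilated Vitali balls. The threshold \<open>\<kappa>\<close> is where small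
  balls centred in a ball begin to fit into its dilate:
  \<open>\<kappa> * (1 + \<epsilon>) \<le> \<sigma>\<close> has a solution
  \<open>\<epsilon> > 0\<close> exactly when \<open>\<kappa> < \<sigma>\<close>. The way from the
  maximal condition to the power condition enlarges the dilation by \<open>2 * \<kappa>\<close>,
  since stopping balls with centres in \<open>Q x r\<close> are only known to lie in
  \<open>Q x (2 * \<kappa> * r)\<close>. Independence of the dilation factor is available for the
  power condition and undoes this loss; so \<open>A_inf\<close> is always compared with power
  classes and never directly with another \<open>A_inf\<close>. A weight may be infinite on a ball;
  this case is split off before numbers are divided.\<close>

section \<open>Covering and countability\<close>

text \<open>Zorn's lemma is applied to the disjoint subfamilies with a property that survives unions
  of chains: a set of \<open>F\<close> that meets the subfamily at all meets a member of at least
  half its radius. If some sets missed a maximal subfamily, one of them with radius above half the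
  supremum of their radii could be added.\<close>

lemma Vitali_selection:
  fixes B :: "'i \<Rightarrow> 'a set" and rad :: "'i \<Rightarrow> real"
  assumes ne: "\<And>i. i \<in> F \<Longrightarrow> B i \<noteq> {}" and bd: "\<And>i. i \<in> F \<Longrightarrow> 0 < rad i \<and> rad i \<le> R"
  obtains J where "J \<subseteq> F" "disjoint_family_on B J"
    "\<And>i. i \<in> F \<Longrightarrow> \<exists>j\<in>J. B i \<inter> B j \<noteq> {} \<and> rad i \<le> 2 * rad j"
proof -
  define \<Omega> where "\<Omega> = {G. G \<subseteq> F \<and> disjoint_family_on B G \<and>
    (\<forall>i\<in>F. (\<exists>j\<in>G. B i \<inter> B j \<noteq> {}) \<longrightarrow> (\<exists>j\<in>G. B i \<inter> B j \<noteq> {} \<and> rad i \<le> 2 * rad j))}"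
  have "\<exists>G\<in>\<Omega>. \<forall>H\<in>\<Omega>. G \<subseteq> H \<longrightarrow> H = G"
  proof (rule subset_Zorn')
    fix \<C> assume c: "subset.chain \<Omega> \<C>"
    then have sub: "\<C> \<subseteq> \<Omega>" and ch: "\<And>G H. G \<in> \<C> \<Longrightarrow> H \<in> \<C> \<Longrightarrow> G \<subseteq> H \<or> H \<subseteq> G"
      by (auto simp: subset_chain_def)
    have "disjoint_family_on B (\<Union>\<C>)"
      unfolding disjoint_family_on_def
    proof (intro ballI impI)
      fix i j assume "i \<in> \<Union>\<C>" "j \<in> \<Union>\<C>" and ij: "i \<noteq> j"
      then obtain G H where "G \<in> \<C>" "H \<in> \<C>" "i \<in> G" "j \<in> H" by auto
      then obtain G where "G \<in> \<C>" "i \<in> G" "j \<in> G" using ch by blast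
      then show "B i \<inter> B j = {}"
        using sub ij by (auto simp: \<Omega>_def disjoint_family_on_def)
    qed
    moreover have "\<Union>\<C> \<subseteq> F" using sub by (auto simp: \<Omega>_def)
    moreover have "\<exists>j\<in>\<Union>\<C>. B i \<inter> B j \<noteq> {} \<and> rad i \<le> 2 * rad j"
      if ij: "i \<in> F" "j \<in> \<Union>\<C>" "B i \<inter> B j \<noteq> {}" for i j
    proof -
      obtain G where "G \<in> \<C>" "j \<in> G" using ij(2) by blast
      moreover from this have "G \<in> \<Omega>" using sub by auto
      ultimately show ?thesis using ij unfolding \<Omega>_def by blast
    qed
    ultimately show "\<Union>\<C> \<in> \<Omega>" unfolding \<Omega>_def by blast
  qed
  then obtain G where G: "G \<in> \<Omega>" and max: "\<And>H. H \<in> \<Omega> \<Longrightarrow> G \<subseteq> H \<Longrightarrow> H = G" by blast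
  define F' where "F' = {i \<in> F. \<forall>j\<in>G. B i \<inter> B j = {}}"
  have "F' = {}"
  proof (rule ccontr)
    assume nonempty: "F' \<noteq> {}"
    have bdd: "bdd_above (rad ` F')"
      using bd by (auto simp: F'_def bdd_above_def)
    obtain i0 where "i0 \<in> F'" using nonempty by auto
    then have "0 < rad i0" "rad i0 \<le> Sup (rad ` F')"
      using bd bdd by (auto simp: F'_def intro: cSup_upper)
    then have "Sup (rad ` F') / 2 < Sup (rad ` F')" by simp
    then obtain i where i: "i \<in> F'" "Sup (rad ` F') / 2 < rad i"
      using less_cSupD[of "rad ` F'"] nonempty by blast
    have le: "rad j \<le> 2 * rad i" if "j \<in> F'" for j
      using cSup_upper[OF _ bdd, of "rad j"] that i by auto
    have "insert i G \<in> \<Omega>"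
      unfolding \<Omega>_def
    proof (intro CollectI conjI ballI impI)
      show "insert i G \<subseteq> F" using G i by (auto simp: \<Omega>_def F'_def)
      have "disjoint_family_on B G" using G by (simp add: \<Omega>_def)
      then show "disjoint_family_on B (insert i G)"
        using i unfolding disjoint_family_on_def F'_def by blast
      fix j assume j: "j \<in> F" and "\<exists>k\<in>insert i G. B j \<inter> B k \<noteq> {}"
      show "\<exists>k\<in>insert i G. B j \<inter> B k \<noteq> {} \<and> rad j \<le> 2 * rad k"
      proof (cases "j \<in> F'")
        case True
        then have "B j \<inter> B i \<noteq> {}"
          using \<open>\<exists>k\<in>insert i G. B j \<inter> B k \<noteq> {}\<close> by (auto simp: F'_def)
        then show ?thesis using le[OF True] by auto
      next
        case False
        then show ?thesis using G j unfolding \<Omega>_def F'_def by blast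
      qed
    qed
    then have "i \<in> G" using max by blast
    then have "B i = {}" using i by (auto simp: F'_def)
    then show False using ne i by (auto simp: F'_def)
  qed
  then show ?thesis
    using G that[of G] unfolding \<Omega>_def F'_def by blast
qed

text \<open>By disjointness, only finitely many of the sets meet a given piece of finite measure in
  measure at least \<open>1 / Suc m\<close>. A set of positive measure does so for some piece and
  some \<open>m\<close>.\<close>

lemma (in sigma_finite_measure) countable_disjoint_family_pos:
  assumes disj: "disjoint_family_on B J"
    and meas: "\<And>j. j \<in> J \<Longrightarrow> B j \<in> sets M" and pos: "\<And>j. j \<in> J \<Longrightarrow> 0 < emeasure M (B j)"
  shows "countable J"
proof -
  obtain W :: "nat \<Rightarrow> 'a set" where W: "range W \<subseteq> sets M" "(\<Union>n. W n) = space M"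
      "\<And>n. emeasure M (W n) \<noteq> \<infinity>"
    using sigma_finite by blast
  define H where "H n m = {j \<in> J. 1 / Suc m \<le> measure M (B j \<inter> W n)}" for n m :: nat
  have fin: "emeasure M (B j \<inter> W n) \<noteq> \<infinity>" if "j \<in> J" for j n
    using W(3)[of n] emeasure_mono[of "B j \<inter> W n" "W n" M] W(1)
    by (auto simp: top_unique)
  have "finite (H n m)" for n m
  proof (rule ccontr)
    assume inf: "infinite (H n m)"
    obtain N :: nat where N: "measure M (W n) * Suc m < N" using reals_Archimedean2 by blast
    obtain T where T: "T \<subseteq> H n m" "finite T" "card T = N"
      using infinite_arbitrarily_large[OF inf] by blast
    have TJ: "T \<subseteq> J" using T by (auto simp: H_def)
    have "N / Suc m = (\<Sum>j\<in>T. 1 / Suc m)" using T by simp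
    also have "\<dots> \<le> (\<Sum>j\<in>T. measure M (B j \<inter> W n))"
      using T by (intro sum_mono) (auto simp: H_def)
    also have "\<dots> = measure M (\<Union>j\<in>T. B j \<inter> W n)"
      using T TJ meas W(1) fin disj
      by (intro measure_finite_Union[symmetric]) (auto simp: disjoint_family_on_def, blast+)
    also have "\<dots> \<le> measure M (W n)"
      using T TJ meas W by (intro measure_mono_fmeasurable sets.finite_UN) (auto simp: fmeasurable_def top.not_eq_extremum)
    finally show False using N by (simp add: field_simps)
  qed
  moreover have "J \<subseteq> (\<Union>n m. H n m)"
  proof
    fix j assume j: "j \<in> J"
    have "\<exists>n. emeasure M (B j \<inter> W n) \<noteq> 0"
    proof (rule ccontr)
      assume "\<not> ?thesis"
      then have "emeasure M (\<Union>n. B j \<inter> W n) = 0"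
        using W meas[OF j] by (intro emeasure_UN_eq_0) auto
      moreover have "(\<Union>n. B j \<inter> W n) = B j"
        using W(2) sets.sets_into_space[OF meas[OF j]] by auto
      ultimately show False using pos[OF j] by simp
    qed
    then obtain n where "0 < measure M (B j \<inter> W n)"
      using fin[OF j] by (metis emeasure_eq_ennreal_measure ennreal_0 infinity_ennreal_def
          measure_nonneg not_less_iff_gr_or_eq order_le_less)
    then obtain m :: nat where "1 / Suc m < measure M (B j \<inter> W n)"
      using reals_Archimedean[of "measure M (B j \<inter> W n)"] by (auto simp: inverse_eq_divide)
    then have "j \<in> H n m" using j by (simp add: H_def)
    then show "j \<in> (\<Union>n m. H n m)" by blast
  qed
  ultimately show ?thesis
    by (meson countable_UN countable_finite countable_subset countableI_type)
qed

text \<open>Overlap of the sets \<open>F j\<close> costs nothing, as each is charged to its own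
  \<open>G j\<close>. The pair of measures varies: \<open>\<nu>\<close> against \<open>\<mu>\<close>
  for stopping balls, \<open>\<nu>\<close> against itself in the iteration, \<open>\<mu>\<close>
  against \<open>\<nu>\<close> in the weak type estimate.\<close>

lemma emeasure_cover_le_disjoint:
  assumes J: "countable J" and sets: "sets N = sets M"
    and disj: "disjoint_family_on G J" and G: "\<And>j. j \<in> J \<Longrightarrow> G j \<in> sets M"
    and F: "\<And>j. j \<in> J \<Longrightarrow> F j \<in> sets M" and E: "E \<subseteq> (\<Union>j\<in>J. F j)"
    and le: "\<And>j. j \<in> J \<Longrightarrow> emeasure N (F j) \<le> c * emeasure M (G j)"
  shows "emeasure N E \<le> c * emeasure M (\<Union>j\<in>J. G j)"
proof -
  \<comment> \<open>Reindexing by natural numbers: \<open>I n\<close> has at most one element, and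
    empty terms pad a finite \<open>J\<close>.\<close>
  define I where "I n = {j \<in> J. to_nat_on J j = n}" for n
  have I: "I n = {} \<or> (\<exists>j\<in>J. I n = {j})" for n
    using inj_on_to_nat_on[OF J] by (fastforce simp: I_def inj_on_def)
  define F' G' where "F' n = (\<Union>j\<in>I n. F j)" and "G' n = (\<Union>j\<in>I n. G j)" for n
  have F': "F' n \<in> sets M" and G': "G' n \<in> sets M"
    and le': "emeasure N (F' n) \<le> c * emeasure M (G' n)" for n
    using I[of n] F G le by (auto simp: F'_def G'_def)
  have UN: "(\<Union>j\<in>J. F j) = (\<Union>n. F' n)" "(\<Union>j\<in>J. G j) = (\<Union>n. G' n)"
    by (auto simp: F'_def G'_def I_def)
  have disj': "disjoint_family G'"
    using disj by (fastforce simp: disjoint_family_on_def G'_def I_def)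
  have "emeasure N E \<le> emeasure N (\<Union>n. F' n)"
    using E UN F' sets by (intro emeasure_mono) auto
  also have "\<dots> \<le> (\<Sum>n. emeasure N (F' n))"
    using F' sets by (intro emeasure_subadditive_countably) auto
  also have "\<dots> \<le> (\<Sum>n. c * emeasure M (G' n))"
    by (intro suminf_le le') auto
  also have "\<dots> = c * emeasure M (\<Union>n. G' n)"
    using suminf_emeasure[of G' M] G' disj' by (simp add: image_subset_iff)
  finally show ?thesis unfolding UN .
qed

subsection \<open>Balls in a space of homogeneous type\<close>

context quasi_metric_space
begin

lemma qball_subset_space: "qball X \<rho> x r \<subseteq> X"
  by (auto simp: qball_def)

lemma qball_mono: "r \<le> s \<Longrightarrow> qball X \<rho> x r \<subseteq> qball X \<rho> x s"
  by (auto simp: qball_def)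

lemma centre_in_qball: "x \<in> X \<Longrightarrow> 0 < r \<Longrightarrow> x \<in> qball X \<rho> x r"
  using zero[of x x] by (simp add: qball_def)

lemma in_qball_commute: "x \<in> X \<Longrightarrow> y \<in> qball X \<rho> x r \<Longrightarrow> x \<in> qball X \<rho> y r"
  by (simp add: qball_def commute)

lemma qball_subset:
  assumes "x \<in> X" "y \<in> qball X \<rho> x a" "\<kappa> * (a + s) \<le> t"
  shows "qball X \<rho> y s \<subseteq> qball X \<rho> x t"
proof
  fix z assume z: "z \<in> qball X \<rho> y s"
  have "\<rho> x z \<le> \<kappa> * (\<rho> x y + \<rho> y z)"
    using quasi_triangle[of x z y] assms z by (auto simp: qball_def)
  also have "\<dots> < \<kappa> * (a + s)"
    using \<kappa>_ge_1 assms z by (intro mult_strict_left_mono add_strict_mono) (auto simp: qball_def)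
  finally show "z \<in> qball X \<rho> x t" using z assms by (auto simp: qball_def)
qed

text \<open>Two uses of the quasi-triangle inequality: \<open>x\<close> is within
  \<open>\<kappa> * (s + t) \<le> 3 * \<kappa> * t\<close> of \<open>y\<close>, and \<open>\<kappa>
  * (3 * \<kappa> * t + 4 * t) \<le> 7 * \<kappa>\<^sup>2 * t\<close>. The doubled ball is covered
  because stopping radii are maximal only up to a factor 2.\<close>

lemma qball_subset_of_meet:
  assumes "x \<in> X" "y \<in> X" "qball X \<rho> x s \<inter> qball X \<rho> y t \<noteq> {}" "s \<le> 2 * t"
  shows "qball X \<rho> x (2 * s) \<subseteq> qball X \<rho> y (7 * \<kappa>\<^sup>2 * t)"
proof -
  obtain z where z: "z \<in> qball X \<rho> x s" "z \<in> qball X \<rho> y t" using assms by auto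
  then have t: "0 < t" using nonneg[of y z] assms by (auto simp: qball_def)
  have "z \<in> X" using z qball_subset_space by auto
  then have "\<rho> y x \<le> \<kappa> * (\<rho> y z + \<rho> z x)" using quasi_triangle[of y x z] assms by auto
  also have "\<dots> < \<kappa> * (3 * t)"
    using z assms \<open>z \<in> X\<close> \<kappa>_ge_1 commute[of x z]
    by (intro mult_strict_left_mono) (auto simp: qball_def)
  finally have "x \<in> qball X \<rho> y (3 * \<kappa> * t)" using assms by (auto simp: qball_def)
  moreover have "\<kappa> * (3 * \<kappa> * t + 2 * s) \<le> 7 * \<kappa>\<^sup>2 * t"
  proof -
    have "2 * s \<le> 4 * (\<kappa> * t)"
      using assms(4) mult_right_mono[OF \<kappa>_ge_1, of t] t by linarith
    then have "\<kappa> * (3 * \<kappa> * t + 2 * s) \<le> \<kappa> * (7 * (\<kappa> * t))"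
      using \<kappa>_ge_1 by (intro mult_left_mono) auto
    then show ?thesis by (simp add: power2_eq_square algebra_simps)
  qed
  ultimately show ?thesis using qball_subset assms by blast
qed

end

context homogeneous_type_space
begin

abbreviation Q :: "'a \<Rightarrow> real \<Rightarrow> 'a set" where "Q x r \<equiv> qball X \<rho> x r"
abbreviation QQ :: "'a \<times> real \<Rightarrow> 'a set" where "QQ p \<equiv> Q (fst p) (snd p)"

lemma qball_measurable [measurable, simp]: "x \<in> X \<Longrightarrow> Q x r \<in> sets \<mu>"
proof (cases "0 < r")
  case False
  assume "x \<in> X"
  then have "Q x r = {}" using False nonneg[of x] by (force simp: qball_def)
  then show ?thesis by simp
qed (rule qball_sets)

text \<open>A crude exponent: \<open>c \<le> 2 ^ nat \<lceil>c\<rceil>\<close> suffices. The maximum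
  with 1 takes care of an empty \<open>X\<close>, where \<open>D\<close> may be any number.\<close>

definition dbl :: "real \<Rightarrow> real" where "dbl c = max 1 D ^ nat \<lceil>c\<rceil>"

lemma dbl_ge_1: "1 \<le> dbl c"
  by (simp add: dbl_def)

lemma emeasure_qball_le_dbl:
  assumes "x \<in> X" "0 < r" "t \<le> c * r"
  shows "emeasure \<mu> (Q x t) \<le> ennreal (dbl c) * emeasure \<mu> (Q x r)"
proof -
  have pow: "emeasure \<mu> (Q x (2 ^ n * r)) \<le> ennreal (max 1 D ^ n) * emeasure \<mu> (Q x r)" for n
  proof (induction n)
    case (Suc n)
    have "emeasure \<mu> (Q x (2 ^ Suc n * r)) \<le> ennreal D * emeasure \<mu> (Q x (2 ^ n * r))"
      using doubling[of x "2 ^ n * r"] assms by (simp add: mult.assoc)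
    also have "\<dots> \<le> ennreal (max 1 D) * (ennreal (max 1 D ^ n) * emeasure \<mu> (Q x r))"
      by (intro mult_mono Suc.IH) (auto intro: ennreal_leI)
    finally show ?case by (simp add: ennreal_mult mult.assoc)
  qed simp
  have "c \<le> 2 ^ nat \<lceil>c\<rceil>"
  proof -
    have "c \<le> real (nat \<lceil>c\<rceil>)" by linarith
    also have "\<dots> \<le> 2 ^ nat \<lceil>c\<rceil>" by (rule less_imp_le[OF of_nat_less_two_power])
    finally show ?thesis .
  qed
  then have "t \<le> 2 ^ nat \<lceil>c\<rceil> * r"
    using assms mult_right_mono[of c "2 ^ nat \<lceil>c\<rceil>" r] by linarith
  then have "emeasure \<mu> (Q x t) \<le> emeasure \<mu> (Q x (2 ^ nat \<lceil>c\<rceil> * r))"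
    using assms by (intro emeasure_mono qball_mono) auto
  then show ?thesis using pow[of "nat \<lceil>c\<rceil>"] by (simp add: dbl_def)
qed

lemma emeasure_subset_qball_finite: "x \<in> X \<Longrightarrow> A \<subseteq> Q x r \<Longrightarrow> emeasure \<mu> A < \<infinity>"
proof (cases "0 < r")
  case True
  assume "x \<in> X" "A \<subseteq> Q x r"
  then show ?thesis using qball_finite[of x r] emeasure_mono[of A "Q x r" \<mu>] True
    by (auto intro: order.strict_trans1)
next
  case False
  assume "x \<in> X" "A \<subseteq> Q x r"
  then have "A = {}" using False nonneg[of x] by (force simp: qball_def)
  then show ?thesis by simp
qed

lemma measure_qball_pos: "x \<in> X \<Longrightarrow> 0 < r \<Longrightarrow> 0 < measure \<mu> (Q x r)"
  using qball_pos[of x r] qball_finite[of x r]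
  by (simp add: measure_def enn2real_positive_iff)

lemma emeasure_qball_eq: "x \<in> X \<Longrightarrow> emeasure \<mu> (Q x r) = ennreal (measure \<mu> (Q x r))"
  using emeasure_subset_qball_finite[of x "Q x r" r] by (intro emeasure_eq_ennreal_measure) auto

lemma space_UN_qball: "x \<in> X \<Longrightarrow> (\<Union>n. Q x (real (Suc n))) = X"
proof -
  have "\<exists>n. \<rho> x y < real (Suc n)" for y
    using reals_Archimedean2[of "\<rho> x y"] by (metis less_Suc_eq less_trans of_nat_less_iff)
  then show ?thesis by (auto simp: qball_def)
qed

lemma sigma_finite: "sigma_finite_measure \<mu>"
proof
  show "\<exists>A. countable A \<and> A \<subseteq> sets \<mu> \<and> \<Union>A = space \<mu> \<and> (\<forall>a\<in>A. emeasure \<mu> a \<noteq> \<infinity>)"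
  proof (cases "X = {}")
    case True
    then show ?thesis by (intro exI[of _ "{}"]) (simp add: space_eq)
  next
    case False
    then obtain x where x: "x \<in> X" by auto
    have "emeasure \<mu> (Q x (real (Suc n))) \<noteq> \<infinity>" for n
      using qball_finite[OF x, of "real (Suc n)"] by (simp del: of_nat_Suc)
    then show ?thesis
      using x space_UN_qball[OF x]
      by (intro exI[of _ "range (\<lambda>n. Q x (real (Suc n)))"]) (auto simp: space_eq simp del: of_nat_Suc)
  qed
qed

lemma Vitali_qballs:
  assumes F: "\<And>p. p \<in> F \<Longrightarrow> fst p \<in> X \<and> 0 < snd p \<and> snd p \<le> R"
  obtains J where "J \<subseteq> F" "countable J" "disjoint_family_on QQ J"
    "\<forall>p\<in>F. \<exists>q\<in>J. snd p \<le> 2 * snd q \<and>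
      Q (fst p) (2 * snd p) \<subseteq> Q (fst q) (7 * \<kappa>\<^sup>2 * snd q)"
proof -
  have "\<And>p. p \<in> F \<Longrightarrow> QQ p \<noteq> {}" using F centre_in_qball by blast
  then obtain J where J: "J \<subseteq> F" "disjoint_family_on QQ J"
    "\<And>p. p \<in> F \<Longrightarrow> \<exists>q\<in>J. QQ p \<inter> QQ q \<noteq> {} \<and> snd p \<le> 2 * snd q"
    using Vitali_selection[of F QQ snd R] F by blast
  interpret sigma_finite_measure \<mu> by (rule sigma_finite)
  have "countable J"
    using J F qball_pos by (intro countable_disjoint_family_pos[of QQ]) auto
  moreover have "\<exists>q\<in>J. snd p \<le> 2 * snd q \<and>
      Q (fst p) (2 * snd p) \<subseteq> Q (fst q) (7 * \<kappa>\<^sup>2 * snd q)" if p: "p \<in> F" for p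
  proof -
    obtain q where q: "q \<in> J" "QQ p \<inter> QQ q \<noteq> {}" "snd p \<le> 2 * snd q"
      using J(3)[OF p] by blast
    then show ?thesis
      using qball_subset_of_meet[of "fst p" "fst q" "snd p" "snd q"] F[OF p] F[of q] J(1) by blast
  qed
  ultimately show ?thesis using J(1,2) that[of J] by blast
qed

text \<open>Disjoint balls of radius \<open>1 / Suc n\<close> are countably many, as each has
  positive measure, and their Vitali dilates cover \<open>X\<close>. So their centres form a net of
  mesh \<open>7 * \<kappa>\<^sup>2 / Suc n\<close>.\<close>

lemma countable_dense:
  obtains S where "countable S" "S \<subseteq> X" "\<And>x e. x \<in> X \<Longrightarrow> 0 < e \<Longrightarrow> \<exists>q\<in>S. \<rho> q x < e"
proof -
  have "\<exists>S. countable S \<and> S \<subseteq> X \<and> (\<forall>x\<in>X. \<exists>q\<in>S. \<rho> q x < 7 * \<kappa>\<^sup>2 * (1 / Suc n))" for n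
  proof -
    have F: "\<And>p. p \<in> X \<times> {1 / real (Suc n)} \<Longrightarrow> fst p \<in> X \<and> 0 < snd p \<and> snd p \<le> 1 / real (Suc n)"
      by auto
    obtain J where J: "J \<subseteq> X \<times> {1 / real (Suc n)}" "countable J" "disjoint_family_on QQ J"
      "\<forall>p\<in>X \<times> {1 / real (Suc n)}. \<exists>q\<in>J. snd p \<le> 2 * snd q \<and>
        Q (fst p) (2 * snd p) \<subseteq> Q (fst q) (7 * \<kappa>\<^sup>2 * snd q)"
      using Vitali_qballs[OF F] by blast
    have "\<exists>q\<in>fst ` J. \<rho> q x < 7 * \<kappa>\<^sup>2 * (1 / Suc n)" if x: "x \<in> X" for x
    proof -
      obtain q where q: "q \<in> J" "Q x (2 * (1 / Suc n)) \<subseteq> Q (fst q) (7 * \<kappa>\<^sup>2 * snd q)"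
        using bspec[OF J(4), of "(x, 1 / real (Suc n))"] x by auto
      moreover have "x \<in> Q x (2 * (1 / Suc n))" using x by (intro centre_in_qball) simp_all
      ultimately have "x \<in> Q (fst q) (7 * \<kappa>\<^sup>2 * snd q)" by blast
      moreover have "snd q = 1 / Suc n" using q J(1) by auto
      ultimately show ?thesis using q(1) by (auto simp: qball_def simp del: of_nat_Suc)
    qed
    then show ?thesis using J(1,2) by (intro exI[of _ "fst ` J"]) (fastforce simp del: of_nat_Suc)
  qed
  then obtain S where S: "\<And>n. countable (S n)" "\<And>n. S n \<subseteq> X"
    "\<And>n x. x \<in> X \<Longrightarrow> \<exists>q\<in>S n. \<rho> q x < 7 * \<kappa>\<^sup>2 * (1 / Suc n)" by metis
  show ?thesis
  proof (rule that[of "\<Union>n. S n"])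
    show "\<exists>q\<in>\<Union>n. S n. \<rho> q x < e" if xe: "x \<in> X" "0 < e" for x e
    proof -
      have k: "0 < 7 * \<kappa>\<^sup>2" using \<kappa>_ge_1 by simp
      then have "0 < e / (7 * \<kappa>\<^sup>2)" using xe by simp
      then obtain n where "1 / Suc n < e / (7 * \<kappa>\<^sup>2)" by (rule nat_approx_posE)
      then have "7 * \<kappa>\<^sup>2 * (1 / Suc n) < e" using k by (simp add: field_simps)
      moreover obtain q where "q \<in> S n" "\<rho> q x < 7 * \<kappa>\<^sup>2 * (1 / Suc n)"
        using S(3)[OF xe(1)] by blast
      ultimately show ?thesis by (intro bexI[of _ q]) auto
    qed
  qed (use S in auto)
qed

subsection \<open>Outer regularity\<close>

text \<open>Balls need not be open, so a neighbourhood is a set containing a ball about each point.\<close>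

definition nbhd :: "'a set \<Rightarrow> 'a set \<Rightarrow> bool"
  where "nbhd A U \<longleftrightarrow> U \<in> sets \<mu> \<and> (\<forall>x\<in>A. \<exists>s>0. Q x s \<subseteq> U)"

lemma nbhd_subset: "nbhd A U \<Longrightarrow> A \<subseteq> X \<Longrightarrow> A \<subseteq> U"
  using centre_in_qball unfolding nbhd_def by blast

lemma nbhd_Int: "nbhd A U \<Longrightarrow> nbhd A V \<Longrightarrow> nbhd A (U \<inter> V)"
  unfolding nbhd_def
proof safe
  fix x assume "\<forall>x\<in>A. \<exists>s>0. Q x s \<subseteq> U" "\<forall>x\<in>A. \<exists>s>0. Q x s \<subseteq> V" "x \<in> A"
  then obtain s t where "0 < s" "0 < t" "Q x s \<subseteq> U" "Q x t \<subseteq> V" by blast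
  then show "\<exists>s>0. Q x s \<subseteq> U \<inter> V"
    using qball_mono[of "min s t" s x] qball_mono[of "min s t" t x]
    by (intro exI[of _ "min s t"]) auto
qed auto

text \<open>A countable intersection of neighbourhoods need not be one, but finite intersections
  are, and continuity from above of a finite measure makes one of them good enough.\<close>

lemma nbhd_Inter_approx:
  assumes fin: "finite_measure M" and sets: "sets M = sets \<mu>"
    and C: "C \<in> sets \<mu>" and V: "\<And>n::nat. nbhd C (V n)"
    and e: "measure M ((\<Inter>n. V n) - C) < e"
  shows "\<exists>U. nbhd C U \<and> measure M (U - C) < e"
proof -
  interpret finite_measure M by fact
  define W where "W n = (\<Inter>k\<le>n. V k)" for n
  have W: "nbhd C (W n)" for n
  proof (induction n)
    case (Suc n)
    then show ?case using nbhd_Int[OF V[of "Suc n"]] by (simp add: W_def atMost_Suc)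
  qed (use V in \<open>simp add: W_def\<close>)
  have "(\<lambda>n. measure M (W n - C)) \<longlonglongrightarrow> measure M (\<Inter>n. W n - C)"
    using W C sets
    by (intro finite_Lim_measure_decseq) (auto simp: nbhd_def W_def decseq_def)
  moreover have "(\<Inter>n. W n - C) = (\<Inter>n. V n) - C" by (auto simp: W_def)
  ultimately have "\<forall>\<^sub>F n in sequentially. measure M (W n - C) < e"
    using e by (intro order_tendstoD(2)) auto
  then show ?thesis using W by (meson eventually_sequentially order_refl)
qed

text \<open>The union of all small balls about points of \<open>X - A\<close> might not be
  measurable, so \<open>V n\<close> takes balls about points of a countable dense set that meet
  \<open>X - A\<close>. A point of \<open>A\<close> is left out as soon as
  \<open>2 * \<kappa> / Suc n\<close> is at most the radius of a ball about it inside
  \<open>A\<close>.\<close>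

lemma closed_nbhds:
  assumes "qopen X \<rho> A"
  shows "\<exists>V::nat \<Rightarrow> 'a set. (\<forall>n. nbhd (X - A) (V n)) \<and> (\<Inter>n. V n) = X - A"
proof -
  obtain S where S: "countable S" "S \<subseteq> X" "\<And>x e. x \<in> X \<Longrightarrow> 0 < e \<Longrightarrow> \<exists>q\<in>S. \<rho> q x < e"
    using countable_dense by blast
  define V where "V n = (\<Union>q\<in>{q \<in> S. Q q (1 / Suc n) \<inter> (X - A) \<noteq> {}}. Q q (1 / Suc n))" for n :: nat
  have "nbhd (X - A) (V n)" for n
    unfolding nbhd_def
  proof (intro conjI ballI)
    show "V n \<in> sets \<mu>"
      unfolding V_def using S by (intro sets.countable_UN' countable_subset[OF _ S(1)]) auto
    fix x assume x: "x \<in> X - A"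
    \<comment> \<open>By the quasi-triangle inequality, two steps shorter than \<open>d\<close> make
      one shorter than \<open>1 / Suc n\<close>.\<close>
    define d where "d = 1 / Suc n / (2 * \<kappa>)"
    have d: "0 < d" "\<kappa> * (d + d) = 1 / Suc n" "d \<le> 1 / Suc n"
    proof -
      have "a / (2 * \<kappa>) \<le> a \<and> 0 < a / (2 * \<kappa>) \<and> \<kappa> * (a / (2 * \<kappa>) + a / (2 * \<kappa>)) = a" if "0 < a" for a :: real
        using \<kappa>_ge_1 that mult_left_mono[of 1 "2 * \<kappa>" a] by (simp add: field_simps)
      from this[of "1 / Suc n"] show "0 < d" "\<kappa> * (d + d) = 1 / Suc n" "d \<le> 1 / Suc n"
        by (simp_all add: d_def)
    qed
    have "Q x d \<subseteq> V n"
    proof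
      fix y assume y: "y \<in> Q x d"
      then have yX: "y \<in> X" using qball_subset_space by auto
      obtain q where q: "q \<in> S" "\<rho> q y < d" using S(3)[OF yX d(1)] by blast
      then have qy: "y \<in> Q q d" using yX by (simp add: qball_def)
      have sub: "Q y d \<subseteq> Q q (1 / Suc n)"
        using qball_subset[OF _ qy, of d "1 / Suc n"] d(2) q(1) S(2) by auto
      have "x \<in> Q y d" using in_qball_commute[OF _ y] x by simp
      then have "x \<in> Q q (1 / Suc n)" using sub by auto
      moreover have "y \<in> Q q (1 / Suc n)" using qball_mono[OF d(3), of q] qy by auto
      ultimately show "y \<in> V n" using q(1) x unfolding V_def by blast
    qed
    then show "\<exists>s>0. Q x s \<subseteq> V n" using d(1) by blast
  qed
  moreover have "(\<Inter>n. V n) \<subseteq> X - A"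
  proof
    fix y assume y: "y \<in> (\<Inter>n. V n)"
    then have "y \<in> V 0" by auto
    then have yX: "y \<in> X" using qball_subset_space by (auto simp: V_def)
    have "y \<notin> A"
    proof
      assume "y \<in> A"
      then obtain r where r: "0 < r" "Q y r \<subseteq> A" using assms by (auto simp: qopen_def)
      then have "0 < r / (2 * \<kappa>)" using \<kappa>_ge_1 by simp
      then obtain n where "1 / Suc n < r / (2 * \<kappa>)" by (rule nat_approx_posE)
      then have n: "\<kappa> * (1 / Suc n + 1 / Suc n) \<le> r" using \<kappa>_ge_1 by (simp add: field_simps)
      obtain q z where q: "q \<in> S" "y \<in> Q q (1 / Suc n)" "z \<in> Q q (1 / Suc n)" "z \<in> X - A"
        using y unfolding V_def by blast
      then have "q \<in> Q y (1 / Suc n)" using in_qball_commute S(2) by blast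
      then have "z \<in> Q y r" using qball_subset[OF yX _ n] q(3) by blast
      then show False using r(2) q(4) by auto
    qed
    then show "y \<in> X - A" using yX by simp
  qed
  ultimately show ?thesis
    using nbhd_subset[of "X - A"] by (intro exI[of _ V]) blast
qed

text \<open>The induction treats a set and its complement together, so complements are free.
  Countable unions get errors that sum to \<open>e / 2\<close>; their complements are countable
  intersections, for which \<open>nbhd_Inter_approx\<close> supplies the neighbourhood.\<close>

lemma finite_measure_outer_regular:
  assumes fin: "finite_measure M" and sets: "sets M = sets \<mu>" and A: "A \<in> sets \<mu>" and "0 < e"
  shows "\<exists>U. nbhd A U \<and> measure M (U - A) < e"
proof -
  interpret finite_measure M by fact
  have "\<forall>e>0. (\<exists>U. nbhd A U \<and> measure M (U - A) < e) \<and> (\<exists>U. nbhd (X - A) U \<and> measure M (U - (X - A)) < e)"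
    using A unfolding sets_eq
  proof (induction rule: sigma_sets.induct)
    case (Basic A)
    then have op: "qopen X \<rho> A" by simp
    then have A: "A \<in> sets \<mu>" by (auto simp: sets_eq)
    then have XA: "X - A \<in> sets \<mu>" using sets.compl_sets[of A \<mu>] by (simp add: space_eq)
    have "nbhd A A" using op A by (simp add: nbhd_def qopen_def)
    then show ?case
      using closed_nbhds[OF op] nbhd_Inter_approx[OF fin sets XA] by fastforce
  next
    case Empty
    have "X \<in> sets \<mu>" using sets.top[of \<mu>] by (simp add: space_eq)
    then have "nbhd {} {}" "nbhd X X"
      using qball_subset_space by (auto simp: nbhd_def intro: exI[of _ 1])
    then show ?case by fastforce
  next
    case (Compl A)
    then have "A \<subseteq> X" using sets.sets_into_space[of A \<mu>] by (simp add: sets_eq space_eq)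
    then have "X - (X - A) = A" by auto
    then show ?case using Compl.IH by simp
  next
    case (Union A)
    have As: "A i \<in> sets \<mu>" for i using Union.hyps by (simp add: sets_eq)
    then have XA: "X - A i \<in> sets \<mu>" for i using sets.compl_sets[of "A i" \<mu>] by (simp add: space_eq)
    show ?case
    proof (intro allI impI)
      fix e :: real assume e: "0 < e"
      define d where "d i = e / 2 * (1 / 2) ^ Suc i" for i
      have dpos: "0 < d i" for i using e by (simp add: d_def)
      have dsum: "d sums (e / 2)"
        using sums_mult[OF power_half_series, of "e / 2"] by (simp add: d_def[abs_def])
      obtain U where U: "\<And>i. nbhd (A i) (U i)" "\<And>i. measure M (U i - A i) < d i"
      proof -
        have "\<forall>i. \<exists>U. nbhd (A i) U \<and> measure M (U - A i) < d i" using Union.IH dpos by blast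
        then show ?thesis using that by metis
      qed
      obtain V where V: "\<And>i. nbhd (X - A i) (V i)" "\<And>i. measure M (V i - (X - A i)) < d i"
      proof -
        have "\<forall>i. \<exists>U. nbhd (X - A i) U \<and> measure M (U - (X - A i)) < d i" using Union.IH dpos by blast
        then show ?thesis using that by metis
      qed
      have small: "measure M (\<Union>i. T i) < e"
        if T: "\<And>i. T i \<in> sets \<mu>" "\<And>i. measure M (T i) < d i" for T
      proof -
        have le: "measure M (T i) \<le> d i" for i using T(2)[of i] by (rule less_imp_le)
        have sm: "summable (\<lambda>i. measure M (T i))"
          by (rule summable_comparison_test'[OF sums_summable[OF dsum], of 0]) (simp add: le)
        have "measure M (\<Union>i. T i) \<le> (\<Sum>i. measure M (T i))"
          using T(1) sets sm by (intro finite_measure_subadditive_countably) auto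
        also have "\<dots> \<le> (\<Sum>i. d i)"
          by (intro suminf_le le sm sums_summable[OF dsum])
        also have "\<dots> = e / 2" using sums_unique[OF dsum] by (rule sym)
        also have "\<dots> < e" using e by simp
        finally show ?thesis .
      qed
      have Us: "U i \<in> sets \<mu>" "V i \<in> sets \<mu>" for i using U V by (auto simp: nbhd_def)
      have "nbhd (\<Union>i. A i) (\<Union>i. U i)"
        unfolding nbhd_def
      proof (intro conjI ballI)
        fix x assume "x \<in> (\<Union>i. A i)"
        then obtain i where "x \<in> A i" by auto
        then obtain s where "0 < s" "Q x s \<subseteq> U i" using U(1)[of i] by (auto simp: nbhd_def)
        then show "\<exists>s>0. Q x s \<subseteq> (\<Union>i. U i)" by blast
      qed (use Us in auto)
      moreover have "measure M ((\<Union>i. U i) - (\<Union>i. A i)) \<le> measure M (\<Union>i. U i - A i)"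
        using Us As sets by (intro finite_measure_mono) auto
      ultimately have 1: "\<exists>U. nbhd (\<Union>i. A i) U \<and> measure M (U - (\<Union>i. A i)) < e"
        using small[of "\<lambda>i. U i - A i"] U(2) Us As by (intro exI[of _ "\<Union>i. U i"]) auto
      have "measure M ((\<Inter>i. V i) - (X - (\<Union>i. A i))) \<le> measure M (\<Union>i. V i - (X - A i))"
        using Us XA sets by (intro finite_measure_mono) auto
      then have "measure M ((\<Inter>i. V i) - (X - (\<Union>i. A i))) < e"
        using small[of "\<lambda>i. V i - (X - A i)"] V(2) Us XA by auto
      moreover have "nbhd (X - (\<Union>i. A i)) (V i)" for i
        using V(1)[of i] by (auto simp: nbhd_def)
      moreover have "X - (\<Union>i. A i) \<in> sets \<mu>"
        using As sets.compl_sets[of "\<Union>i. A i" \<mu>] by (auto simp: space_eq)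
      ultimately show "(\<exists>U. nbhd (\<Union>i. A i) U \<and> measure M (U - (\<Union>i. A i)) < e) \<and>
          (\<exists>U. nbhd (X - (\<Union>i. A i)) U \<and> measure M (U - (X - (\<Union>i. A i))) < e)"
        using 1 nbhd_Inter_approx[OF fin sets] by blast
    qed
  qed
  then show ?thesis using \<open>0 < e\<close> by blast
qed

text \<open>Restricting the measure to a ball that is a neighbourhood of \<open>E\<close> makes it
  finite, and cutting \<open>U\<close> down to that ball keeps it a neighbourhood of
  \<open>E\<close>.\<close>

lemma outer_regular:
  assumes x: "x \<in> X" and r: "0 < r" and E: "E \<in> sets \<mu>" "E \<subseteq> Q x r" and e: "0 < e"
  obtains U where "nbhd E U" "emeasure \<mu> U \<le> emeasure \<mu> E + ennreal e"
proof -
  define B where "B = Q x (\<kappa> * (r + r))"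
  have B: "B \<in> sets \<mu>" "emeasure \<mu> B < \<infinity>"
    using x emeasure_subset_qball_finite[of x B] by (auto simp: B_def)
  define M where "M = density \<mu> (indicator B)"
  have em: "emeasure M A = emeasure \<mu> (A \<inter> B)" if "A \<in> sets \<mu>" for A
    using that B by (simp add: M_def emeasure_density Int_commute indicator_inter_arith[symmetric] mult.commute)
  have sets: "sets M = sets \<mu>" by (simp add: M_def)
  have "finite_measure M"
    using em[OF sets.top] B emeasure_mono[of "space \<mu> \<inter> B" B \<mu>]
    by (intro finite_measureI) (auto simp: M_def top_unique)
  then obtain U where U: "nbhd E U" "measure M (U - E) < e"
    using finite_measure_outer_regular[OF _ sets E(1) e] by blast
  interpret finite_measure M by fact
  have Us: "U \<in> sets \<mu>" using U by (simp add: nbhd_def)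
  have "nbhd E B"
    unfolding nbhd_def
  proof (intro conjI ballI B(1))
    fix y assume "y \<in> E"
    then show "\<exists>s>0. Q y s \<subseteq> B"
      using E(2) r qball_subset[OF x, of y r r "\<kappa> * (r + r)"] unfolding B_def by blast
  qed
  then have "nbhd E (U \<inter> B)" using nbhd_Int U by blast
  moreover have "emeasure \<mu> (U \<inter> B) \<le> emeasure \<mu> (E \<union> (U - E) \<inter> B)"
    using Us E B by (intro emeasure_mono) auto
  moreover have "\<dots> \<le> emeasure \<mu> E + emeasure \<mu> ((U - E) \<inter> B)"
    using Us E B by (intro emeasure_subadditive) auto
  moreover have "emeasure \<mu> ((U - E) \<inter> B) \<le> ennreal e"
    using U(2) em[of "U - E"] Us E by (metis emeasure_eq_measure ennreal_leI less_imp_le sets.Diff)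
  ultimately show ?thesis using that[of "U \<inter> B"] by (meson add_left_mono order_trans)
qed

end

subsection \<open>Decay of the level sets for weights in \<open>A_inf\<close>\<close>

text \<open>The halved terms add up to at most the full largest one, whichever levels
  \<open>P\<close> selects.\<close>

lemma sum_powers_le:
  fixes c m :: real
  assumes "0 \<le> c" "0 \<le> m" "\<And>k. k < n \<Longrightarrow> P k \<Longrightarrow> 2 ^ k * c \<le> m"
  shows "(\<Sum>k<n. if P k then 2 ^ k * c / 2 else 0) \<le> m"
  using assms(3)
proof (induction n)
  case (Suc n)
  show ?case
  proof (cases "P n")
    case True
    have pow: "(\<Sum>k<j. 2 ^ k * c / 2) \<le> 2 ^ j * c / 2" for j
      using assms(1) by (induction j) auto
    have "(\<Sum>k<Suc n. if P k then 2 ^ k * c / 2 else 0) \<le> (\<Sum>k<Suc n. 2 ^ k * c / 2)"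
      using assms(1) by (intro sum_mono) auto
    also have "\<dots> \<le> 2 ^ Suc n * c / 2" by (rule pow)
    also have "\<dots> \<le> m" using Suc.prems[OF _ True] by simp
    finally show ?thesis .
  next
    case False
    then show ?thesis using Suc by simp
  qed
qed (use assms in simp)

context homogeneous_type_space
begin

text \<open>An average above \<open>l\<close>, written as a product so that infinite weights need no
  separate case. This is not topological density.\<close>

definition dense :: "'a measure \<Rightarrow> real \<Rightarrow> 'a \<Rightarrow> real \<Rightarrow> bool"
  where "dense N l x s \<longleftrightarrow> ennreal l * emeasure \<mu> (Q x s) < emeasure N (Q x s)"

lemma not_denseD: "\<not> dense N l x s \<Longrightarrow> emeasure N (Q x s) \<le> ennreal l * emeasure \<mu> (Q x s)"
  by (simp add: dense_def)

lemma dense_antimono: "dense N l x s \<Longrightarrow> k \<le> l \<Longrightarrow> dense N k x s"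
  unfolding dense_def by (meson ennreal_leI mult_right_mono order.strict_trans1 zero_le)

text \<open>Each centre gets a dense radius whose double exceeds all its dense radii up to
  \<open>r\<close>, and Vitali selection thins these balls out. By \<open>small\<close> the chosen
  radii are at most \<open>r / \<theta>\<close>, which leaves room for dilations by factors from 2
  to \<open>\<theta>\<close>, where the average is still at most \<open>l\<close>.\<close>

lemma stopping_balls:
  assumes Z: "Z \<subseteq> X" "\<And>x. x \<in> Z \<Longrightarrow> \<exists>s. 0 < s \<and> s \<le> r \<and> dense N l x s"
    and small: "\<And>x s. x \<in> Z \<Longrightarrow> 0 < s \<Longrightarrow> s \<le> r \<Longrightarrow> r < \<theta> * s \<Longrightarrow> \<not> dense N l x s"
  obtains J where "countable J" "disjoint_family_on QQ J"
    "\<And>p. p \<in> J \<Longrightarrow> fst p \<in> Z \<and> 0 < snd p \<and> \<theta> * snd p \<le> r \<and> dense N l (fst p) (snd p)"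
    "\<And>p t. p \<in> J \<Longrightarrow> 2 * snd p \<le> t \<Longrightarrow> t \<le> r \<Longrightarrow> \<not> dense N l (fst p) t"
    "\<And>x s. x \<in> Z \<Longrightarrow> 0 < s \<Longrightarrow> s \<le> r \<Longrightarrow> dense N l x s \<Longrightarrow>
      \<exists>p\<in>J. Q x s \<subseteq> Q (fst p) (7 * \<kappa>\<^sup>2 * snd p)"
proof -
  have "\<exists>s. 0 < s \<and> s \<le> r \<and> dense N l x s \<and> (\<forall>t. 0 < t \<longrightarrow> t \<le> r \<longrightarrow> dense N l x t \<longrightarrow> t < 2 * s)"
    if x: "x \<in> Z" for x
  proof -
    define S where "S = {s. 0 < s \<and> s \<le> r \<and> dense N l x s}"
    obtain s0 where s0: "s0 \<in> S" using Z(2)[OF x] by (auto simp: S_def)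
    have bdd: "bdd_above S" by (auto simp: S_def bdd_above_def)
    have "0 < Sup S" using cSup_upper[OF s0 bdd] s0 by (auto simp: S_def)
    then have "Sup S / 2 < Sup S" by simp
    then obtain s where s: "s \<in> S" "Sup S / 2 < s" using less_cSupD[of S] s0 by blast
    have "t < 2 * s" if "t \<in> S" for t using cSup_upper[OF that bdd] s(2) by simp
    then show ?thesis using s(1) by (auto simp: S_def)
  qed
  then obtain sel where sel: "\<And>x. x \<in> Z \<Longrightarrow> 0 < sel x \<and> sel x \<le> r \<and> dense N l x (sel x)"
    "\<And>x t. x \<in> Z \<Longrightarrow> 0 < t \<Longrightarrow> t \<le> r \<Longrightarrow> dense N l x t \<Longrightarrow> t < 2 * sel x"
    by metis
  define F where "F = (\<lambda>x. (x, sel x)) ` Z"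
  have F: "\<And>p. p \<in> F \<Longrightarrow> fst p \<in> X \<and> 0 < snd p \<and> snd p \<le> r"
    using sel(1) Z(1) by (auto simp: F_def)
  obtain J where J: "J \<subseteq> F" "countable J" "disjoint_family_on QQ J"
    "\<forall>p\<in>F. \<exists>q\<in>J. snd p \<le> 2 * snd q \<and> Q (fst p) (2 * snd p) \<subseteq> Q (fst q) (7 * \<kappa>\<^sup>2 * snd q)"
    using Vitali_qballs[OF F] by blast
  have JF: "fst p \<in> Z \<and> snd p = sel (fst p)" if "p \<in> J" for p
    using J(1) that by (auto simp: F_def)
  show ?thesis
  proof (rule that[OF J(2,3)])
    fix p assume p: "p \<in> J"
    show "fst p \<in> Z \<and> 0 < snd p \<and> \<theta> * snd p \<le> r \<and> dense N l (fst p) (snd p)"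
      using JF[OF p] sel(1)[of "fst p"] small[of "fst p" "snd p"] by force
    fix t assume "2 * snd p \<le> t" "t \<le> r"
    then show "\<not> dense N l (fst p) t"
      using JF[OF p] sel(1)[of "fst p"] sel(2)[of "fst p" t] by force
  next
    fix x s assume x: "x \<in> Z" "0 < s" "s \<le> r" "dense N l x s"
    have "(x, sel x) \<in> F" using x by (simp add: F_def)
    then obtain q where q: "q \<in> J" "Q x (2 * sel x) \<subseteq> Q (fst q) (7 * \<kappa>\<^sup>2 * snd q)"
      using J(4) by fastforce
    have "Q x s \<subseteq> Q x (2 * sel x)" using sel(2)[OF x] by (intro qball_mono) simp
    then show "\<exists>p\<in>J. Q x s \<subseteq> Q (fst p) (7 * \<kappa>\<^sup>2 * snd p)" using q by blast
  qed
qed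

text \<open>When \<open>s\<close> is comparable to \<open>r\<close>, the measure of
  \<open>Q x r\<close> is at most a constant times that of \<open>Q y s\<close>, and
  \<open>Q y s\<close> lies in \<open>Q x t\<close>. So the average over \<open>Q y s\<close> is at
  most that constant times \<open>l\<close>. This verifies the hypothesis \<open>small\<close> of
  \<open>stopping_balls\<close>.\<close>

lemma not_dense_large_radius:
  assumes sets: "sets N = sets \<mu>" and x: "x \<in> X" and y: "y \<in> Q x r"
    and s: "0 < s" "s \<le> r" "r < \<theta> * s" and T: "2 * \<kappa> * r \<le> t"
    and l: "0 \<le> l" "emeasure N (Q x t) \<le> ennreal l * emeasure \<mu> (Q x r)"
    and k: "dbl (2 * \<kappa> * \<theta>) * l \<le> k"
  shows "\<not> dense N k y s"
proof -
  have yX: "y \<in> X" using y qball_subset_space by auto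
  have eq: "\<kappa> * (r + r) = 2 * \<kappa> * r" by simp
  have "Q y s \<subseteq> Q x t"
    using qball_mono[OF s(2), of y] qball_subset[OF x y, of r t] T eq by auto
  then have "emeasure N (Q y s) \<le> ennreal l * emeasure \<mu> (Q x r)"
    using x sets l(2) by (intro order_trans[OF emeasure_mono l(2)]) auto
  also have "emeasure \<mu> (Q x r) \<le> emeasure \<mu> (Q y (2 * \<kappa> * r))"
    using qball_subset[OF yX in_qball_commute[OF x y], of r "2 * \<kappa> * r"] yX
    by (intro emeasure_mono) auto
  also have "\<dots> \<le> ennreal (dbl (2 * \<kappa> * \<theta>)) * emeasure \<mu> (Q y s)"
    using s \<kappa>_ge_1 by (intro emeasure_qball_le_dbl yX) (auto simp: mult.assoc)
  also have "ennreal l * \<dots> = ennreal (dbl (2 * \<kappa> * \<theta>) * l) * emeasure \<mu> (Q y s)"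
    using l(1) dbl_ge_1[of "2 * \<kappa> * \<theta>"] by (simp add: ennreal_mult mult.assoc mult.left_commute)
  also have "\<dots> \<le> ennreal k * emeasure \<mu> (Q y s)" using k by (intro mult_right_mono ennreal_leI) auto
  finally show ?thesis by (auto simp: dense_def mult_left_mono)
qed

definition wmeasure :: "('a \<Rightarrow> real) \<Rightarrow> 'a measure"
  where "wmeasure w = density \<mu> (\<lambda>x. ennreal (w x))"

lemma sets_wmeasure [simp]: "sets (wmeasure w) = sets \<mu>"
  by (simp add: wmeasure_def)

lemma weight_of_eq:
  "weight X \<mu> w \<Longrightarrow> A \<in> sets \<mu> \<Longrightarrow> weight_of \<mu> w A = emeasure (wmeasure w) A"
  unfolding weight_def weight_of_def wmeasure_def by (subst emeasure_density) auto

lemma nn_integral_abs_restrict: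
  assumes w: "weight X \<mu> w" and "A \<in> sets \<mu>" "B \<in> sets \<mu>"
  shows "(\<integral>\<^sup>+y\<in>A. ennreal \<bar>indicator B y * w y\<bar> \<partial>\<mu>) = emeasure (wmeasure w) (A \<inter> B)"
proof -
  have "(\<integral>\<^sup>+y\<in>A. ennreal \<bar>indicator B y * w y\<bar> \<partial>\<mu>) = weight_of \<mu> w (A \<inter> B)"
    unfolding weight_of_def
    using w by (intro nn_integral_cong) (auto simp: weight_def space_eq split: split_indicator)
  then show ?thesis using weight_of_eq[OF w] assms by simp
qed

lemma maximal_ge:
  assumes w: "weight X \<mu> w" and z: "z \<in> X" "0 < s" "y \<in> Q z s" "Q z s \<subseteq> B" and B: "B \<in> sets \<mu>"
    and d: "dense (wmeasure w) l z s"
  shows "ennreal l \<le> maximal X \<rho> \<mu> (\<lambda>z. indicator B z * w z) y"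
proof -
  have "ennreal l = ennreal l * emeasure \<mu> (Q z s) / emeasure \<mu> (Q z s)"
    using qball_pos[OF z(1,2)] qball_finite[OF z(1,2)] by (simp add: mult_divide_eq_ennreal)
  also have "\<dots> \<le> emeasure (wmeasure w) (Q z s \<inter> B) / emeasure \<mu> (Q z s)"
    using d z(4) by (intro divide_right_mono_ennreal) (simp add: dense_def Int_absorb2)
  also have "\<dots> \<le> maximal X \<rho> \<mu> (\<lambda>z. indicator B z * w z) y"
    unfolding maximal_def
    using z nn_integral_abs_restrict[OF w _ B, of "Q z s"] by (intro SUP_upper2[of "(z, s)"]) auto
  finally show ?thesis .
qed

text \<open>
  The stopping balls of all levels \<open>2 ^ k\<close> with \<open>k < n\<close> contribute comparably to the integral of the
  maximal function, and the union at level \<open>n\<close> is covered by dilates of those at each lower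
  level. Hence its weight is at most a constant multiple of \<open>1 / n\<close> times the weight of the dilated ball.
\<close>

lemma log_decay:
  fixes n :: nat
  assumes w: "weight X \<mu> w" and \<sigma>: "1 \<le> \<sigma>" and C: "0 \<le> C"
    and H: "\<And>x r. x \<in> X \<Longrightarrow> 0 < r \<Longrightarrow>
      (\<integral>\<^sup>+y\<in>Q x r. maximal X \<rho> \<mu> (\<lambda>z. indicator (Q x r) z * w z) y \<partial>\<mu>)
        \<le> ennreal C * weight_of \<mu> w (Q x (\<sigma> * r))"
    and x: "x \<in> X" and r: "0 < r" and l: "0 < l"
    and bound: "emeasure (wmeasure w) (Q x (2 * \<kappa> * \<sigma> * r)) \<le> ennreal l * emeasure \<mu> (Q x r)"
    and \<theta>: "7 * \<kappa>\<^sup>2 \<le> \<theta>" and k: "k = 2 ^ n * (dbl (2 * \<kappa> * \<theta>) * l)"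
  obtains J where "countable J" "disjoint_family_on QQ J"
    "\<And>p. p \<in> J \<Longrightarrow> fst p \<in> Q x r \<and> 0 < snd p \<and> \<theta> * snd p \<le> r \<and> dense (wmeasure w) k (fst p) (snd p)"
    "\<And>p t. p \<in> J \<Longrightarrow> 2 * snd p \<le> t \<Longrightarrow> t \<le> r \<Longrightarrow> \<not> dense (wmeasure w) k (fst p) t"
    "\<And>y s. y \<in> Q x r \<Longrightarrow> 0 < s \<Longrightarrow> s \<le> r \<Longrightarrow> dense (wmeasure w) k y s \<Longrightarrow>
      \<exists>p\<in>J. Q y s \<subseteq> Q (fst p) (7 * \<kappa>\<^sup>2 * snd p)"
    "of_nat n * emeasure (wmeasure w) (\<Union>p\<in>J. QQ p) \<le>
      ennreal (2 * dbl \<theta> * C) * emeasure (wmeasure w) (Q x (2 * \<kappa> * \<sigma> * r))"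
proof -
  define N where "N = wmeasure w"
  have sets: "sets N = sets \<mu>" by (simp add: N_def)
  \<comment> \<open>From this level on, \<open>not_dense_large_radius\<close> excludes dense balls
    of radius above \<open>r / \<theta>\<close>.\<close>
  define c where "c = dbl (2 * \<kappa> * \<theta>) * l"
  have c: "0 < c" using dbl_ge_1[of "2 * \<kappa> * \<theta>"] l unfolding c_def by (intro mult_pos_pos) auto
  define L where "L j = 2 ^ j * c" for j :: nat
  have L: "L j = 2 ^ j * c" for j by (simp add: L_def)
  have Ln: "L n = k" by (simp add: L k c_def)
  have Lpos: "0 < L k" and Lge: "c \<le> L k" for k
    using c mult_right_mono[of 1 "2 ^ k" c] by (simp_all add: L)
  have "1 \<le> \<kappa>\<^sup>2" using \<kappa>_ge_1 by (simp add: one_le_power)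
  then have \<theta>': "1 \<le> \<theta>" "2 \<le> 7 * \<kappa>\<^sup>2" using \<theta> by simp_all
  have rr: "2 * \<kappa> * r \<le> 2 * \<kappa> * \<sigma> * r" using \<sigma> r \<kappa>_ge_1 by simp
  define Z where "Z k = {y \<in> Q x r. \<exists>s. 0 < s \<and> s \<le> r \<and> dense N (L k) y s}" for k
  define P where "P k J \<longleftrightarrow> countable J \<and> disjoint_family_on QQ J \<and>
    (\<forall>p\<in>J. fst p \<in> Z k \<and> 0 < snd p \<and> \<theta> * snd p \<le> r \<and> dense N (L k) (fst p) (snd p)) \<and>
    (\<forall>p\<in>J. \<forall>t. 2 * snd p \<le> t \<longrightarrow> t \<le> r \<longrightarrow> \<not> dense N (L k) (fst p) t) \<and>
    (\<forall>y\<in>Z k. \<forall>s. 0 < s \<longrightarrow> s \<le> r \<longrightarrow> dense N (L k) y s \<longrightarrow>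
      (\<exists>p\<in>J. Q y s \<subseteq> Q (fst p) (7 * \<kappa>\<^sup>2 * snd p)))" for k J
  have "\<exists>J. P k J" for k
  proof -
    have 1: "Z k \<subseteq> X" using qball_subset_space by (auto simp: Z_def)
    have 2: "\<And>y. y \<in> Z k \<Longrightarrow> \<exists>s. 0 < s \<and> s \<le> r \<and> dense N (L k) y s" by (auto simp: Z_def)
    have 3: "\<not> dense N (L k) y s" if "y \<in> Z k" "0 < s" "s \<le> r" "r < \<theta> * s" for y s
      using that Lge[of k] l bound
      by (intro not_dense_large_radius[OF sets x _ _ _ _ rr]) (auto simp: Z_def c_def N_def)
    show ?thesis
      by (rule stopping_balls[OF 1 2 3], assumption+) (unfold P_def, blast)
  qed
  then obtain J where PJ: "\<And>k. P k (J k)" by metis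
  have J: "\<And>k. countable (J k)" "\<And>k. disjoint_family_on QQ (J k)"
    "\<And>k p. p \<in> J k \<Longrightarrow> fst p \<in> Z k \<and> 0 < snd p \<and> \<theta> * snd p \<le> r \<and> dense N (L k) (fst p) (snd p)"
    "\<And>k p t. p \<in> J k \<Longrightarrow> 2 * snd p \<le> t \<Longrightarrow> t \<le> r \<Longrightarrow> \<not> dense N (L k) (fst p) t"
    "\<And>k y s. y \<in> Z k \<Longrightarrow> 0 < s \<Longrightarrow> s \<le> r \<Longrightarrow> dense N (L k) y s \<Longrightarrow>
      \<exists>p\<in>J k. Q y s \<subseteq> Q (fst p) (7 * \<kappa>\<^sup>2 * snd p)"
    using PJ unfolding P_def by blast+
  have JX: "fst p \<in> X" "fst p \<in> Q x r" "snd p \<le> r" if "p \<in> J k" for p k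
  proof -
    show "fst p \<in> Q x r" using J(3)[OF that] by (simp add: Z_def)
    then show "fst p \<in> X" using qball_subset_space by auto
    have "1 * snd p \<le> \<theta> * snd p" using J(3)[OF that] \<theta>'(1) by (intro mult_right_mono) auto
    then show "snd p \<le> r" using J(3)[OF that] by linarith
  qed
  define A where "A k = (\<Union>p\<in>J k. QQ p)" for k
  have Am: "A k \<in> sets \<mu>" for k
    unfolding A_def using J(1) JX by (intro sets.countable_UN') auto
  \<comment> \<open>A ball dense at level \<open>n\<close> is dense at level \<open>k\<close>, hence
    inside a dilate of a ball from \<open>J k\<close>. The dilated radius lies between
    \<open>2 * snd p\<close> and \<open>r\<close>, so the average there is at most
    \<open>L k\<close>, and doubling leads back to the ball itself.\<close>
  have step: "emeasure N (A n) \<le> ennreal (L k * dbl \<theta>) * emeasure \<mu> (A k)" if kn: "k \<le> n" for k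
    unfolding A_def[of k]
  proof (rule emeasure_cover_le_disjoint[OF J(1) sets J(2), where F = "\<lambda>p. Q (fst p) (7 * \<kappa>\<^sup>2 * snd p)"])
    show "A n \<subseteq> (\<Union>p\<in>J k. Q (fst p) (7 * \<kappa>\<^sup>2 * snd p))"
    proof
      fix y assume "y \<in> A n"
      then obtain p where p: "p \<in> J n" "y \<in> QQ p" by (auto simp: A_def)
      have "L k \<le> L n" using kn c by (simp add: L)
      then have d: "dense N (L k) (fst p) (snd p)" using J(3)[OF p(1)] dense_antimono by blast
      then have "fst p \<in> Z k" using J(3)[OF p(1)] JX[OF p(1)] by (auto simp: Z_def)
      then show "y \<in> (\<Union>p\<in>J k. Q (fst p) (7 * \<kappa>\<^sup>2 * snd p))"
        using J(5)[OF _ _ _ d] J(3)[OF p(1)] JX[OF p(1)] p(2) by blast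
    qed
    fix p assume p: "p \<in> J k"
    show "QQ p \<in> sets \<mu>" "Q (fst p) (7 * \<kappa>\<^sup>2 * snd p) \<in> sets \<mu>" using JX[OF p] by auto
    have s: "0 < snd p" "\<theta> * snd p \<le> r" using J(3)[OF p] by auto
    have "2 * snd p \<le> 7 * \<kappa>\<^sup>2 * snd p" "7 * \<kappa>\<^sup>2 * snd p \<le> \<theta> * snd p"
      using s \<theta> \<theta>' by (auto intro!: mult_right_mono)
    then have "emeasure N (Q (fst p) (7 * \<kappa>\<^sup>2 * snd p)) \<le>
        ennreal (L k) * emeasure \<mu> (Q (fst p) (7 * \<kappa>\<^sup>2 * snd p))"
      using s by (intro not_denseD J(4)[OF p]) linarith+
    also have "emeasure \<mu> (Q (fst p) (7 * \<kappa>\<^sup>2 * snd p)) \<le> ennreal (dbl \<theta>) * emeasure \<mu> (QQ p)"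
      using JX[OF p] s \<open>7 * \<kappa>\<^sup>2 * snd p \<le> \<theta> * snd p\<close> by (intro emeasure_qball_le_dbl) auto
    finally show "emeasure N (Q (fst p) (7 * \<kappa>\<^sup>2 * snd p)) \<le> ennreal (L k * dbl \<theta>) * emeasure \<mu> (QQ p)"
      using Lpos[of k] dbl_ge_1[of \<theta>] by (simp add: ennreal_mult mult.assoc mult_left_mono)
  qed
  \<comment> \<open>The stopping balls have centres in \<open>Q x r\<close> and radii at most
    \<open>r\<close>, so they lie in this ball. Applying \<open>H\<close> to it is what costs the
    factor \<open>2 * \<kappa>\<close> in the dilation.\<close>
  define B where "B = Q x (2 * \<kappa> * r)"
  have Bm: "B \<in> sets \<mu>" using x by (simp add: B_def)
  define M where "M = maximal X \<rho> \<mu> (\<lambda>z. indicator B z * w z)"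
  have mem: "y \<in> B" "ennreal (L k) \<le> M y" if y: "y \<in> A k" for y k
  proof -
    obtain p where p: "p \<in> J k" "y \<in> QQ p" using y by (auto simp: A_def)
    have sub: "QQ p \<subseteq> B"
      using qball_subset[OF x JX(2)[OF p(1)], of "snd p" "2 * \<kappa> * r"] JX(3)[OF p(1)] \<kappa>_ge_1
      unfolding B_def by (simp add: mult.assoc mult_left_mono)
    then show "y \<in> B" using p by auto
    show "ennreal (L k) \<le> M y"
      unfolding M_def using J(3)[OF p(1)] JX[OF p(1)] p sub
      by (intro maximal_ge[OF w _ _ p(2) sub Bm]) (auto simp: N_def)
  qed
  \<comment> \<open>The left side is measurable, so it bounds the lower integral of the right side
    from below and can be integrated term by term.\<close>
  have pt: "(\<Sum>k<n. ennreal (L k / 2) * indicator (A k) y) \<le> M y * indicator B y" for y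
  proof (cases "\<exists>k<n. y \<in> A k")
    case False
    then have "(\<Sum>k<n. ennreal (L k / 2) * indicator (A k) y) = 0" by (intro sum.neutral) auto
    then show ?thesis by simp
  next
    case True
    then have yB: "y \<in> B" using mem by blast
    have eq: "(\<Sum>k<n. ennreal (L k / 2) * indicator (A k) y) =
        ennreal (\<Sum>k<n. if y \<in> A k then 2 ^ k * c / 2 else 0)"
    proof (subst sum_ennreal[symmetric])
      show "(\<Sum>k<n. ennreal (L k / 2) * indicator (A k) y) =
          (\<Sum>k<n. ennreal (if y \<in> A k then 2 ^ k * c / 2 else 0))"
        by (intro sum.cong refl) (simp add: L indicator_def)
    qed (use c in simp)
    show ?thesis
    proof (cases "M y")
      case (real m)
      have "(\<Sum>k<n. if y \<in> A k then 2 ^ k * c / 2 else 0) \<le> m"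
      proof (rule sum_powers_le)
        fix k assume "y \<in> A k"
        then have "ennreal (L k) \<le> ennreal m" using mem(2) real by metis
        then show "2 ^ k * c \<le> m" using real by (simp add: L)
      qed (use c real in auto)
      then show ?thesis using eq yB real by (simp add: ennreal_leI)
    qed (use yB in simp)
  qed
  have "of_nat n * emeasure N (A n) = (\<Sum>k<n. emeasure N (A n))" by simp
  also have "\<dots> \<le> (\<Sum>k<n. ennreal (2 * dbl \<theta>) * (ennreal (L k / 2) * emeasure \<mu> (A k)))"
  proof (rule sum_mono)
    fix k assume "k \<in> {..<n}"
    moreover have "L k * dbl \<theta> = 2 * dbl \<theta> * (L k / 2)" by simp
    ultimately show "emeasure N (A n) \<le> ennreal (2 * dbl \<theta>) * (ennreal (L k / 2) * emeasure \<mu> (A k))"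
      using step[of k] dbl_ge_1[of \<theta>] Lpos[of k]
      by (simp only: mult.assoc[symmetric] ennreal_mult[symmetric]) (simp add: ennreal_mult[symmetric] mult_ac)
  qed
  also have "\<dots> = ennreal (2 * dbl \<theta>) * (\<integral>\<^sup>+y. (\<Sum>k<n. ennreal (L k / 2) * indicator (A k) y) \<partial>\<mu>)"
    using Am by (subst nn_integral_sum) (auto simp: nn_integral_cmult_indicator sum_distrib_left)
  also have "\<dots> \<le> ennreal (2 * dbl \<theta>) * (\<integral>\<^sup>+y. M y * indicator B y \<partial>\<mu>)"
    by (intro mult_left_mono nn_integral_mono pt) auto
  also have "\<dots> \<le> ennreal (2 * dbl \<theta>) * (ennreal C * weight_of \<mu> w (Q x (\<sigma> * (2 * \<kappa> * r))))"
    using H[OF x, of "2 * \<kappa> * r"] r \<kappa>_ge_1 unfolding M_def B_def by (intro mult_left_mono) auto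
  also have "\<dots> = ennreal (2 * dbl \<theta> * C) * emeasure N (Q x (2 * \<kappa> * \<sigma> * r))"
    using x C dbl_ge_1[of \<theta>]
    by (simp add: weight_of_eq[OF w] N_def ennreal_mult mult_ac)
  finally have fin: "of_nat n * emeasure N (A n) \<le> \<dots>" .
  show ?thesis
  proof (rule that[of "J n"])
    show "\<And>y s. y \<in> Q x r \<Longrightarrow> 0 < s \<Longrightarrow> s \<le> r \<Longrightarrow> dense (wmeasure w) k y s \<Longrightarrow>
      \<exists>p\<in>J n. Q y s \<subseteq> Q (fst p) (7 * \<kappa>\<^sup>2 * snd p)"
      using J(5)[of _ n] unfolding Z_def N_def Ln by blast
  qed (use J(1,2)[of n] J(3,4)[where k = n] JX fin in \<open>auto simp: N_def A_def Ln\<close>)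
qed

end

section \<open>From one-step decay to the power condition\<close>

text \<open>With \<open>u = t powr (1 / (2 * a))\<close> and \<open>2 ^ n\<close> within a factor 2
  below \<open>1 / u\<close>, the first term is at most \<open>2 * u\<close>. Since
  \<open>t = u ^ a * u ^ a\<close>, the growth \<open>(2 ^ a) ^ n\<close> uses up one factor
  \<open>u ^ a\<close> and the other is at most \<open>u\<close>; this is the reason for the 2 in
  the exponent.\<close>

lemma dyadic_interpolation:
  fixes K t :: real
  assumes "1 \<le> a" "0 \<le> K" "0 < t" "t \<le> 1"
  shows "\<exists>n. (1/2) ^ n + K * (2 ^ a) ^ n * t \<le> (2 + K) * t powr (1 / (2 * real a))"
proof -
  define u where "u = t powr (1 / (2 * real a))"
  have u: "0 < u" "u \<le> 1" using assms by (auto simp: u_def powr_le1)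
  have t: "t = u ^ a * u ^ a"
  proof -
    have "u ^ (2 * a) = u powr real (2 * a)" using u by (intro powr_realpow[symmetric])
    also have "\<dots> = t" using assms by (simp add: u_def powr_powr)
    finally show ?thesis by (simp add: mult_2 power_add)
  qed
  define n where "n = nat \<lfloor>log 2 (1 / u)\<rfloor>"
  have lg: "0 \<le> log 2 (1 / u)" using u by simp
  have n: "real n \<le> log 2 (1 / u)" "log 2 (1 / u) < real (Suc n)"
    using lg unfolding n_def by linarith+
  have "2 powr real n \<le> 1 / u"
    using n(1) u by (subst (asm) le_log_iff) auto
  then have le: "2 ^ n * u \<le> 1" using u by (simp add: powr_realpow field_simps)
  have "1 / u < 2 powr real (Suc n)"
    using n(2) u by (subst (asm) log_less_iff) auto
  then have "1 / u < 2 ^ Suc n" by (simp add: powr_realpow del: of_nat_Suc)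
  then have "(1/2) ^ n \<le> 2 * u" using u by (simp add: field_simps power_divide)
  moreover have "(2 ^ a) ^ n * t \<le> u"
  proof -
    have "(2 ^ a) ^ n * t = (2 ^ n * u) ^ a * u ^ a"
      by (simp add: t power_mult[symmetric] power_mult_distrib mult.commute mult.left_commute)
    also have "\<dots> \<le> 1 * u ^ 1"
      using le u assms(1) by (intro mult_mono power_le_one power_decreasing) auto
    finally show ?thesis by simp
  qed
  then have "K * ((2 ^ a) ^ n * t) \<le> K * u" using assms by (intro mult_left_mono) auto
  ultimately have "(1/2) ^ n + K * (2 ^ a) ^ n * t \<le> (2 + K) * u" by (simp add: algebra_simps)
  then show ?thesis unfolding u_def by blast
qed

context homogeneous_type_space
begin

text \<open>
  Choosing \<open>n0\<close> large in \<open>log_decay\<close> gains a factor \<open>1/2\<close> in one step. The dilates of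
  the stopping balls satisfy the hypothesis again at level \<open>c * L\<close>, which makes the statement
  self-improving by induction; no bounded overlap of these dilates is needed, because the average
  of the weight over them is at most \<open>L\<close> while it exceeds \<open>L\<close> on the disjoint stopping balls.
\<close>

lemma level_decay:
  assumes w: "weight X \<mu> w" and \<sigma>: "1 \<le> \<sigma>" and C: "0 \<le> C"
    and H: "\<And>x r. x \<in> X \<Longrightarrow> 0 < r \<Longrightarrow>
      (\<integral>\<^sup>+y\<in>Q x r. maximal X \<rho> \<mu> (\<lambda>z. indicator (Q x r) z * w z) y \<partial>\<mu>)
        \<le> ennreal C * weight_of \<mu> w (Q x (\<sigma> * r))"
  defines "N \<equiv> wmeasure w" and "\<tau> \<equiv> 2 * \<kappa> * \<sigma>"
  obtains a :: nat where "1 \<le> a"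
    "\<And>n x r l E. x \<in> X \<Longrightarrow> 0 < r \<Longrightarrow> 0 < l \<Longrightarrow> E \<in> sets \<mu> \<Longrightarrow> E \<subseteq> Q x r \<Longrightarrow>
      emeasure N (Q x (\<tau> * r)) \<le> ennreal l * emeasure \<mu> (Q x r) \<Longrightarrow>
      (\<And>y. y \<in> E \<Longrightarrow> \<exists>s. 0 < s \<and> s \<le> r \<and> dense N ((2 ^ a) ^ n * l) y s) \<Longrightarrow>
      emeasure N E \<le> ennreal ((1/2) ^ n) * emeasure N (Q x (\<tau> * r))"
proof -
  have sets: "sets N = sets \<mu>" by (simp add: N_def)
  have k2: "1 \<le> \<kappa>\<^sup>2" "\<kappa> \<le> \<kappa>\<^sup>2" using \<kappa>_ge_1 self_le_power[of \<kappa> 2] by (simp_all add: one_le_power)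
  define K where "K = 7 * \<kappa>\<^sup>2"
  have K: "2 \<le> K" "2 * \<kappa> \<le> K" "3 * \<kappa>\<^sup>2 \<le> K" using k2 \<kappa>_ge_1 unfolding K_def by linarith+
  have "1 * 1 \<le> \<kappa> * \<sigma>" using \<kappa>_ge_1 \<sigma> by (intro mult_mono) auto
  then have \<tau>: "1 \<le> \<tau>" by (simp add: \<tau>_def)
  have "2 * \<kappa> * 1 \<le> 2 * \<kappa> * \<sigma>" using \<kappa>_ge_1 \<sigma> by (intro mult_left_mono) auto
  then have \<tau>': "2 * \<kappa> \<le> \<tau>" by (simp add: \<tau>_def)
  \<comment> \<open>For a stopping ball of radius \<open>s\<close> the induction is applied to
    radius \<open>K * s\<close> with dilation \<open>\<tau>\<close>; this \<open>\<theta>\<close>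
    keeps \<open>\<tau> * (K * s)\<close> at most \<open>r\<close>.\<close>
  define \<theta> where "\<theta> = \<tau> * K"
  have "1 * K \<le> \<theta>" "\<tau> * 1 \<le> \<theta>" unfolding \<theta>_def using \<tau> K by (auto intro: mult_mono)
  then have \<theta>: "K \<le> \<theta>" "\<tau> \<le> \<theta>" by simp_all
  define c1 c where "c1 = dbl (2 * \<kappa> * \<theta>)" and "c = dbl \<theta>"
  have c: "1 \<le> c1" "1 \<le> c" by (simp_all add: c1_def c_def dbl_ge_1)
  \<comment> \<open>One factor \<open>c\<close> comes from returning from dilated balls to stopping
    balls, the other from \<open>log_decay\<close>; the choice makes
    \<open>c / n0 * (2 * c * C)\<close> at most \<open>1 / 2\<close>.\<close>
  obtain n0 :: nat where "4 * c * c * C + 1 \<le> n0" using real_arch_simple by blast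
  then have n0: "0 < n0" "4 * c * c * C \<le> n0"
  proof -
    have "0 \<le> 4 * c * c * C" using c C by (intro mult_nonneg_nonneg) auto
    then have "0 < real n0" using \<open>4 * c * c * C + 1 \<le> n0\<close> by linarith
    then show "0 < n0" by simp
    show "4 * c * c * C \<le> n0" using \<open>4 * c * c * C + 1 \<le> n0\<close> by linarith
  qed
  \<comment> \<open>One factor \<open>2 ^ a\<close> pays for the rise from \<open>l\<close> to the
    next base level \<open>c * L\<close>. The summand 1 forces \<open>a\<close> to be
    positive.\<close>
  obtain a :: nat where a: "c * (2 ^ n0 * c1) + 1 < 2 ^ a" using real_arch_pow[of 2] by force
  have a1: "1 \<le> a"
  proof (rule ccontr)
    assume "\<not> 1 \<le> a"
    then have "a = 0" by simp
    then have "c * (2 ^ n0 * c1) < 0" using a by simp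
    moreover have "0 \<le> c * (2 ^ n0 * c1)" using c by (intro mult_nonneg_nonneg) auto
    ultimately show False by simp
  qed
  have claim: "emeasure N E \<le> ennreal ((1/2) ^ n) * emeasure N (Q x (\<tau> * r))"
    if "x \<in> X" "0 < r" "0 < l" "E \<in> sets \<mu>" "E \<subseteq> Q x r"
      "emeasure N (Q x (\<tau> * r)) \<le> ennreal l * emeasure \<mu> (Q x r)"
      "\<forall>y\<in>E. \<exists>s. 0 < s \<and> s \<le> r \<and> dense N ((2 ^ a) ^ n * l) y s"
    for n x r l E
    using that
  proof (induction n arbitrary: x r l E)
    case 0
    have "1 * r \<le> \<tau> * r" using \<tau> 0 by (intro mult_right_mono) auto
    then have "E \<subseteq> Q x (\<tau> * r)" using qball_mono[of r "\<tau> * r" x] 0 by auto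
    then show ?case using 0 sets by (simp add: emeasure_mono)
  next
    case (Suc n)
    note x = Suc.prems(1) and r = Suc.prems(2) and l = Suc.prems(3) and E = Suc.prems(4,5)
      and bound = Suc.prems(6)
    define L where "L = 2 ^ n0 * (c1 * l)"
    obtain J where J: "countable J" "disjoint_family_on QQ J"
      "\<And>p. p \<in> J \<Longrightarrow> fst p \<in> Q x r \<and> 0 < snd p \<and> \<theta> * snd p \<le> r \<and> dense N L (fst p) (snd p)"
      "\<And>p t. p \<in> J \<Longrightarrow> 2 * snd p \<le> t \<Longrightarrow> t \<le> r \<Longrightarrow> \<not> dense N L (fst p) t"
      "\<And>y s. y \<in> Q x r \<Longrightarrow> 0 < s \<Longrightarrow> s \<le> r \<Longrightarrow> dense N L y s \<Longrightarrow>
        \<exists>p\<in>J. Q y s \<subseteq> Q (fst p) (K * snd p)"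
      "of_nat n0 * emeasure N (\<Union>p\<in>J. QQ p) \<le> ennreal (2 * c * C) * emeasure N (Q x (\<tau> * r))"
      by (rule log_decay[OF w \<sigma> C H x r l bound[unfolded N_def \<tau>_def] \<theta>(1)[unfolded K_def]
          L_def[unfolded c1_def], folded N_def \<tau>_def K_def c_def], assumption+, rule that; blast)
    have Lpos: "0 < L" using c l by (simp add: L_def)
    have lev: "L \<le> c * L" "(2 ^ a) ^ n * (c * L) \<le> (2 ^ a) ^ Suc n * l" "c * L \<le> (2 ^ a) ^ Suc n * l"
    proof -
      show "L \<le> c * L" using c Lpos by simp
      have "c * L = c * (2 ^ n0 * c1) * l" by (simp add: L_def)
      also have "\<dots> \<le> 2 ^ a * l" using a l by (intro mult_right_mono) auto
      finally have *: "c * L \<le> 2 ^ a * l" .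
      then have "(2 ^ a) ^ n * (c * L) \<le> (2 ^ a) ^ n * (2 ^ a * l)" by (intro mult_left_mono) auto
      then show **: "(2 ^ a) ^ n * (c * L) \<le> (2 ^ a) ^ Suc n * l" by (simp add: mult_ac)
      have "1 * (c * L) \<le> (2 ^ a) ^ n * (c * L)"
        using c Lpos by (intro mult_right_mono) (auto simp: one_le_power)
      then show "c * L \<le> (2 ^ a) ^ Suc n * l"
        using order_trans[OF _ **] by (simp only: mult_1_left)
    qed
    have dens: "\<exists>s. 0 < s \<and> s \<le> r \<and> dense N ((2 ^ a) ^ n * (c * L)) y s \<and> dense N (c * L) y s \<and> dense N L y s"
      if y: "y \<in> E" for y
    proof -
      obtain s where s: "0 < s" "s \<le> r" "dense N ((2 ^ a) ^ Suc n * l) y s"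
        using Suc.prems(7) y by blast
      have "dense N ((2 ^ a) ^ n * (c * L)) y s" "dense N (c * L) y s"
        using dense_antimono[OF s(3) lev(2)] dense_antimono[OF s(3) lev(3)] by auto
      moreover from this(2) have "dense N L y s" using lev(1) by (rule dense_antimono)
      ultimately show ?thesis using s(1,2) by blast
    qed
    have JX: "fst p \<in> X" if "p \<in> J" for p
      using J(3)[OF that] qball_subset_space by auto
    have "emeasure N E \<le> ennreal ((1/2) ^ n * c) * emeasure N (\<Union>p\<in>J. QQ p)"
    proof (rule emeasure_cover_le_disjoint[OF J(1) refl J(2), where F = "\<lambda>p. E \<inter> Q (fst p) (K * snd p)"])
      show "E \<subseteq> (\<Union>p\<in>J. E \<inter> Q (fst p) (K * snd p))"
      proof
        fix y assume y: "y \<in> E"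
        then obtain s where s: "0 < s" "s \<le> r" "dense N L y s" using dens by blast
        then obtain p where "p \<in> J" "Q y s \<subseteq> Q (fst p) (K * snd p)" using J(5) y E(2) by blast
        moreover have "y \<in> Q y s" using s(1) y E(2) qball_subset_space by (intro centre_in_qball) auto
        ultimately show "y \<in> (\<Union>p\<in>J. E \<inter> Q (fst p) (K * snd p))" using y by blast
      qed
      fix p assume p: "p \<in> J"
      define y s u where "y = fst p" and "s = snd p" and "u = K * s"
      have y: "y \<in> X" "y \<in> Q x r" and s: "0 < s" "\<theta> * s \<le> r" and dp: "dense N L y s"
        using J(3)[OF p] JX[OF p] by (auto simp: y_def s_def)
      have nd: "emeasure N (Q y t) \<le> ennreal L * emeasure \<mu> (Q y t)" if "2 * s \<le> t" "t \<le> r" for t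
        using J(4)[OF p, of t] that by (intro not_denseD) (auto simp: y_def s_def)
      show "QQ p \<in> sets N" "E \<inter> Q (fst p) (K * snd p) \<in> sets N" using JX[OF p] E sets by auto
      have u: "0 < u" "2 * s \<le> u" using s K by (auto simp: u_def intro: mult_right_mono)
      have \<tau>u: "\<tau> * u = \<theta> * s" by (simp add: \<theta>_def u_def)
      have u\<tau>: "u \<le> \<tau> * u" "\<tau> * u \<le> \<theta> * u"
        using u(1) \<tau> \<theta>(2) mult_right_mono[of 1 \<tau> u] by (auto intro: mult_right_mono)
      have b1: "emeasure N (Q y (\<tau> * u)) \<le> ennreal L * emeasure \<mu> (Q y (\<tau> * u))"
        using u u\<tau> \<tau>u s by (intro nd) linarith+
      have "emeasure N (E \<inter> Q y u) \<le> ennreal ((1/2) ^ n) * emeasure N (Q y (\<tau> * u))"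
      proof (rule Suc.IH[OF y(1) u(1)])
        show "0 < c * L" using c Lpos by simp
        show "E \<inter> Q y u \<in> sets \<mu>" "E \<inter> Q y u \<subseteq> Q y u" using E y by auto
        have "emeasure \<mu> (Q y (\<tau> * u)) \<le> ennreal c * emeasure \<mu> (Q y u)"
          unfolding c_def by (intro emeasure_qball_le_dbl y u u\<tau>)
        then have "ennreal L * emeasure \<mu> (Q y (\<tau> * u)) \<le> ennreal L * (ennreal c * emeasure \<mu> (Q y u))"
          by (intro mult_left_mono) auto
        also have "\<dots> = ennreal (c * L) * emeasure \<mu> (Q y u)"
          using c Lpos by (simp add: ennreal_mult mult_ac)
        finally show "emeasure N (Q y (\<tau> * u)) \<le> ennreal (c * L) * emeasure \<mu> (Q y u)"
          using b1 by simp
        show "\<forall>z\<in>E \<inter> Q y u. \<exists>t. 0 < t \<and> t \<le> u \<and> dense N ((2 ^ a) ^ n * (c * L)) z t"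
        proof
          fix z assume z: "z \<in> E \<inter> Q y u"
          then have zX: "z \<in> X" using qball_subset_space by auto
          obtain t where t: "0 < t" "t \<le> r" "dense N ((2 ^ a) ^ n * (c * L)) z t"
            "dense N (c * L) z t" "dense N L z t" using dens z by blast
          \<comment> \<open>The induction hypothesis needs the dense ball about \<open>z\<close> to
            have radius at most \<open>u\<close>. A larger one with
            \<open>2 * \<kappa> * t \<le> r\<close> is comparable to
            \<open>Q y (2 * \<kappa> * t)\<close>, where the stopping rule keeps the average at most
            \<open>L\<close>, against density at level \<open>c * L\<close>. If
            \<open>2 * \<kappa> * t\<close> exceeds \<open>r\<close>,
            \<open>not_dense_large_radius\<close> contradicts density at level
            \<open>L\<close>.\<close>
          have "t \<le> u"
          proof (rule ccontr)
            assume "\<not> t \<le> u"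
            then have ut: "u < t" by simp
            show False
            proof (cases "2 * \<kappa> * t \<le> r")
              case True
              have "\<kappa> * (u + t) \<le> \<kappa> * (2 * t)" using ut \<kappa>_ge_1 by (intro mult_left_mono) auto
              then have "Q z t \<subseteq> Q y (2 * \<kappa> * t)"
                using z by (intro qball_subset[OF y(1), of z u]) auto
              then have "emeasure N (Q z t) \<le> emeasure N (Q y (2 * \<kappa> * t))"
                using y sets by (intro emeasure_mono) auto
              also have "\<dots> \<le> ennreal L * emeasure \<mu> (Q y (2 * \<kappa> * t))"
              proof (rule nd[OF _ True])
                have "2 * t \<le> 2 * \<kappa> * t" using t \<kappa>_ge_1 by simp
                then show "2 * s \<le> 2 * \<kappa> * t" using u ut t by linarith
              qed
              also have "emeasure \<mu> (Q y (2 * \<kappa> * t)) \<le> emeasure \<mu> (Q z (3 * \<kappa>\<^sup>2 * t))"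
              proof -
                have "1 * u \<le> \<kappa> * t" using ut u \<kappa>_ge_1 by (intro mult_mono) auto
                then have "\<kappa> * (u + 2 * \<kappa> * t) \<le> \<kappa> * (3 * (\<kappa> * t))"
                  using \<kappa>_ge_1 by (intro mult_left_mono) auto
                then have "Q y (2 * \<kappa> * t) \<subseteq> Q z (3 * \<kappa>\<^sup>2 * t)"
                  using z in_qball_commute[OF y(1), of z u]
                  by (intro qball_subset[OF zX, of y u]) (auto simp: power2_eq_square mult_ac)
                then show ?thesis using zX by (intro emeasure_mono) auto
              qed
              also have "\<dots> \<le> ennreal c * emeasure \<mu> (Q z t)"
                unfolding c_def using K \<theta> t by (intro emeasure_qball_le_dbl zX mult_right_mono) auto
              also have "ennreal L * \<dots> = ennreal (c * L) * emeasure \<mu> (Q z t)"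
                using c Lpos by (simp add: ennreal_mult mult_ac)
              finally show False using t(4) by (auto simp: dense_def mult_left_mono)
            next
              case False
              have "2 * \<kappa> * t \<le> \<theta> * t" using K \<theta> t by (intro mult_right_mono) auto
              then have "r < \<theta> * t" using False by linarith
              moreover have "c1 * l \<le> L"
                using c l mult_right_mono[of 1 "2 ^ n0" "c1 * l"] by (simp add: L_def)
              moreover have "2 * \<kappa> * r \<le> \<tau> * r" using \<tau>' r by (intro mult_right_mono) auto
              ultimately have "\<not> dense N L z t"
                using z E t l bound unfolding c1_def
                by (intro not_dense_large_radius[OF sets x, of z r t \<theta> "\<tau> * r" l L]) auto
              then show False using t(5) by simp
            qed
          qed
          then show "\<exists>t. 0 < t \<and> t \<le> u \<and> dense N ((2 ^ a) ^ n * (c * L)) z t" using t by blast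
        qed
      qed
      also have "emeasure N (Q y (\<tau> * u)) \<le> ennreal c * emeasure N (Q y s)"
      proof -
        have "emeasure \<mu> (Q y (\<tau> * u)) \<le> ennreal c * emeasure \<mu> (Q y s)"
          unfolding c_def \<tau>u by (intro emeasure_qball_le_dbl y s) auto
        then have "ennreal L * emeasure \<mu> (Q y (\<tau> * u)) \<le> ennreal L * (ennreal c * emeasure \<mu> (Q y s))"
          by (intro mult_left_mono) auto
        also have "\<dots> = ennreal c * (ennreal L * emeasure \<mu> (Q y s))" by (simp add: mult_ac)
        also have "\<dots> \<le> ennreal c * emeasure N (Q y s)"
          using dp by (intro mult_left_mono) (auto simp: dense_def)
        finally show ?thesis using b1 by simp
      qed
      finally show "emeasure N (E \<inter> Q (fst p) (K * snd p)) \<le> ennreal ((1/2) ^ n * c) * emeasure N (QQ p)"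
        using c by (simp add: y_def u_def s_def ennreal_mult mult.assoc mult_left_mono)
    qed
    also have "\<dots> = ennreal ((1/2) ^ n * (c / n0)) * (of_nat n0 * emeasure N (\<Union>p\<in>J. QQ p))"
    proof -
      have "ennreal ((1/2) ^ n * c) = ennreal ((1/2) ^ n * (c / n0)) * ennreal (real n0)"
        using c n0 by (subst ennreal_mult[symmetric]) auto
      then show ?thesis by (simp add: mult.assoc ennreal_of_nat_eq_real_of_nat)
    qed
    also have "\<dots> \<le> ennreal ((1/2) ^ n * (c / n0)) * (ennreal (2 * c * C) * emeasure N (Q x (\<tau> * r)))"
      by (intro mult_left_mono J(6)) auto
    also have "\<dots> = ennreal ((1/2) ^ n * (c / n0) * (2 * c * C)) * emeasure N (Q x (\<tau> * r))"
      using c C by (subst ennreal_mult) (auto simp: mult.assoc)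
    also have "\<dots> \<le> ennreal ((1/2) ^ Suc n) * emeasure N (Q x (\<tau> * r))"
    proof (intro mult_right_mono ennreal_leI)
      have "c / n0 * (2 * c * C) \<le> 1 / 2" using n0 by (simp add: field_simps)
      then have "(1/2) ^ n * (c / n0 * (2 * c * C)) \<le> (1/2) ^ n * (1 / 2)" by (intro mult_left_mono) auto
      then show "(1/2) ^ n * (c / n0) * (2 * c * C) \<le> (1/2) ^ Suc n" by (simp add: mult.assoc)
    qed auto
    finally show ?case .
  qed
  show ?thesis by (rule that[OF a1]) (use claim in blast)
qed

text \<open>
  Replaces the Lebesgue differentiation theorem: together with outer regularity it bounds the weight
  of the points at which no small ball has average above \<open>l\<close>.
\<close>

lemma cover_low_density:
  assumes sets: "sets N = sets \<mu>" and Z: "Z \<subseteq> X" and r: "0 < r" and U: "nbhd Z U" and l: "0 \<le> l"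
    and nd: "\<And>y s. y \<in> Z \<Longrightarrow> 0 < s \<Longrightarrow> s \<le> r \<Longrightarrow> \<not> dense N l y s"
  obtains V where "V \<in> sets \<mu>" "Z \<subseteq> V"
    "emeasure N V \<le> ennreal (dbl (7 * \<kappa>\<^sup>2) * l) * emeasure \<mu> U"
proof -
  define K where "K = 7 * \<kappa>\<^sup>2"
  have "1 \<le> \<kappa>\<^sup>2" using \<kappa>_ge_1 by (simp add: one_le_power)
  then have K: "0 < K" unfolding K_def by linarith
  \<comment> \<open>Radii at most \<open>r / K\<close> keep the dilated Vitali balls in the range of
    \<open>nd\<close>, while the undilated ones stay in \<open>U\<close>.\<close>
  have "\<exists>s. 0 < s \<and> s \<le> r / K \<and> Q y s \<subseteq> U" if y: "y \<in> Z" for y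
  proof -
    obtain s where "0 < s" "Q y s \<subseteq> U" using U y by (auto simp: nbhd_def)
    then show ?thesis using qball_mono[of "min s (r / K)" s y] r K
      by (intro exI[of _ "min s (r / K)"]) auto
  qed
  then obtain sel where sel: "\<And>y. y \<in> Z \<Longrightarrow> 0 < sel y \<and> sel y \<le> r / K \<and> Q y (sel y) \<subseteq> U"
    by metis
  define F where "F = (\<lambda>y. (y, sel y)) ` Z"
  have F: "\<And>p. p \<in> F \<Longrightarrow> fst p \<in> X \<and> 0 < snd p \<and> snd p \<le> r / K"
    using sel Z by (auto simp: F_def)
  obtain J where J: "J \<subseteq> F" "countable J" "disjoint_family_on QQ J"
    "\<forall>p\<in>F. \<exists>q\<in>J. snd p \<le> 2 * snd q \<and> Q (fst p) (2 * snd p) \<subseteq> Q (fst q) (7 * \<kappa>\<^sup>2 * snd q)"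
    using Vitali_qballs[OF F] by blast
  define V where "V = (\<Union>p\<in>J. Q (fst p) (K * snd p))"
  have Vm: "V \<in> sets \<mu>" unfolding V_def using J F by (intro sets.countable_UN') auto
  moreover have "Z \<subseteq> V"
  proof
    fix y assume y: "y \<in> Z"
    then have "(y, sel y) \<in> F" by (simp add: F_def)
    then obtain q where "q \<in> J" "Q y (2 * sel y) \<subseteq> Q (fst q) (K * snd q)"
      using J(4) unfolding K_def by fastforce
    moreover have "y \<in> Q y (2 * sel y)" using sel[OF y] y Z by (intro centre_in_qball) auto
    ultimately show "y \<in> V" by (auto simp: V_def)
  qed
  moreover have "emeasure N V \<le> ennreal (dbl K * l) * emeasure \<mu> U"
  proof -
    have "emeasure N V \<le> ennreal (dbl K * l) * emeasure \<mu> (\<Union>p\<in>J. QQ p)"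
    proof (rule emeasure_cover_le_disjoint[OF J(2) sets J(3), where F = "\<lambda>p. Q (fst p) (K * snd p)"])
      fix p assume p: "p \<in> J"
      then have pF: "p \<in> F" using J(1) by auto
      show "QQ p \<in> sets \<mu>" "Q (fst p) (K * snd p) \<in> sets \<mu>" using F[OF pF] by auto
      have "fst p \<in> Z" using pF by (auto simp: F_def)
      moreover have "0 < K * snd p" "K * snd p \<le> r" using F[OF pF] K by (simp_all add: field_simps)
      ultimately have "emeasure N (Q (fst p) (K * snd p)) \<le> ennreal l * emeasure \<mu> (Q (fst p) (K * snd p))"
        using nd by (intro not_denseD) auto
      also have "\<dots> \<le> ennreal l * (ennreal (dbl K) * emeasure \<mu> (QQ p))"
        using F[OF pF] by (intro mult_left_mono emeasure_qball_le_dbl[OF _ _ order_refl]) auto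
      finally show "emeasure N (Q (fst p) (K * snd p)) \<le> ennreal (dbl K * l) * emeasure \<mu> (QQ p)"
        using l dbl_ge_1[of K] by (simp add: ennreal_mult mult_ac)
    qed (simp add: V_def)
    also have "\<dots> \<le> ennreal (dbl K * l) * emeasure \<mu> U"
      using J(1) sel U by (intro mult_left_mono emeasure_mono) (auto simp: F_def nbhd_def, blast)
    finally show ?thesis .
  qed
  ultimately show ?thesis using that unfolding K_def by blast
qed

text \<open>A point of \<open>E\<close> either has a ball of radius at most \<open>r\<close> with
  average above \<open>(2 ^ a) ^ n * l\<close> or has none. \<open>level_decay\<close> bounds the
  weight of the former points, \<open>cover_low_density\<close> with \<open>outer_regular\<close>
  that of the latter. Since \<open>n\<close> is free, \<open>dyadic_interpolation\<close> yields the
  power condition with \<open>p = 2 * a\<close>.\<close>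

lemma A_inf_subset_script_A_inf:
  assumes \<sigma>: "1 \<le> \<sigma>"
  shows "A_inf X \<rho> \<mu> \<sigma> \<subseteq> script_A_inf X \<rho> \<mu> (2 * \<kappa> * \<sigma>)"
proof
  fix w assume "w \<in> A_inf X \<rho> \<mu> \<sigma>"
  then obtain C where w: "weight X \<mu> w" and C: "0 \<le> C"
    and H: "\<And>x r. x \<in> X \<Longrightarrow> 0 < r \<Longrightarrow>
      (\<integral>\<^sup>+y\<in>Q x r. maximal X \<rho> \<mu> (\<lambda>z. indicator (Q x r) z * w z) y \<partial>\<mu>)
        \<le> ennreal C * weight_of \<mu> w (Q x (\<sigma> * r))"
    unfolding A_inf_def by blast
  define N where "N = wmeasure w"
  define \<tau> where "\<tau> = 2 * \<kappa> * \<sigma>"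
  have sets: "sets N = sets \<mu>" by (simp add: N_def)
  have "1 * 1 \<le> \<kappa> * \<sigma>" using \<kappa>_ge_1 \<sigma> by (intro mult_mono) auto
  then have \<tau>: "1 \<le> \<tau>" by (simp add: \<tau>_def)
  obtain a :: nat where a: "1 \<le> a"
    and decay: "\<And>n x r l E. x \<in> X \<Longrightarrow> 0 < r \<Longrightarrow> 0 < l \<Longrightarrow> E \<in> sets \<mu> \<Longrightarrow> E \<subseteq> Q x r \<Longrightarrow>
      emeasure N (Q x (\<tau> * r)) \<le> ennreal l * emeasure \<mu> (Q x r) \<Longrightarrow>
      (\<And>y. y \<in> E \<Longrightarrow> \<exists>s. 0 < s \<and> s \<le> r \<and> dense N ((2 ^ a) ^ n * l) y s) \<Longrightarrow>
      emeasure N E \<le> ennreal ((1/2) ^ n) * emeasure N (Q x (\<tau> * r))"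
    by (rule level_decay[OF w \<sigma> C H, folded N_def \<tau>_def], assumption+, rule that; blast)
  define k where "k = dbl (7 * \<kappa>\<^sup>2)"
  have k: "1 \<le> k" by (simp add: k_def dbl_ge_1)
  have bound: "emeasure N E \<le> ennreal ((1/2) ^ n + k * (2 ^ a) ^ n * (measure \<mu> E / measure \<mu> (Q x r)))
      * emeasure N (Q x (\<tau> * r))"
    if x: "x \<in> X" and r: "0 < r" and E: "E \<in> sets \<mu>" "E \<subseteq> Q x r" for x r E n
  proof -
    have "1 * r \<le> \<tau> * r" using \<tau> r by (intro mult_right_mono) auto
    then have sub: "E \<subseteq> Q x (\<tau> * r)" using qball_mono[of r "\<tau> * r" x] E by auto
    have le: "emeasure N E \<le> emeasure N (Q x (\<tau> * r))"
      using sub sets x by (intro emeasure_mono) auto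
    define b m \<Lambda> where "b = measure \<mu> (Q x r)" and "m = measure \<mu> E" and "\<Lambda> = (2 ^ a) ^ n * (1::real)"
    have b: "0 < b" using measure_qball_pos[OF x r] by (simp add: b_def)
    have m: "0 \<le> m" "emeasure \<mu> E = ennreal m"
      using emeasure_subset_qball_finite[OF x E(2)]
      by (auto simp: m_def intro!: emeasure_eq_ennreal_measure)
    have \<Lambda>: "0 < \<Lambda>" by (simp add: \<Lambda>_def)
    have fac: "0 < (1/2) ^ n + k * \<Lambda> * (m / b)"
      using k \<Lambda> m b by (intro add_pos_nonneg mult_nonneg_nonneg) auto
    show ?thesis
    proof (cases "emeasure N (Q x (\<tau> * r))")
      case top
      have "ennreal ((1/2) ^ n + k * \<Lambda> * (m / b)) \<noteq> 0" using fac by (simp add: ennreal_eq_0_iff)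
      then show ?thesis using top by (simp add: ennreal_mult_top \<Lambda>_def m_def b_def)
    next
      case (real v)
      show ?thesis
      proof (cases "v = 0")
        case True
        then show ?thesis using le real by simp
      next
        case False
        then have v: "0 < v" using real by simp
        obtain e where e: "0 \<le> e" "emeasure N E = ennreal e"
          using le real by (cases "emeasure N E") (auto simp: top_unique)
        \<comment> \<open>At this level the hypothesis of \<open>decay\<close> is an equality, and
          \<open>l * m\<close> is \<open>m / b\<close> times \<open>v\<close>, as the power
          condition requires.\<close>
        define l where "l = v / b"
        have l: "0 < l" using v b by (simp add: l_def)
        have vb: "emeasure N (Q x (\<tau> * r)) \<le> ennreal l * emeasure \<mu> (Q x r)"
          using emeasure_qball_eq[OF x, of r] b l real
          by (simp add: b_def[symmetric] ennreal_mult[symmetric] l_def)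
        have "e \<le> (1/2) ^ n * v + k * (\<Lambda> * l) * m + \<epsilon>" if \<epsilon>: "0 < \<epsilon>" for \<epsilon>
        proof -
          define \<delta> where "\<delta> = \<epsilon> / (k * (\<Lambda> * l))"
          have kl: "0 < k * (\<Lambda> * l)" using k \<Lambda> l by (intro mult_pos_pos) auto
          have \<delta>: "0 < \<delta>" "k * (\<Lambda> * l) * \<delta> = \<epsilon>" using \<epsilon> kl by (auto simp: \<delta>_def)
          obtain U where U: "nbhd E U" "emeasure \<mu> U \<le> emeasure \<mu> E + ennreal \<delta>"
            using outer_regular[OF x r E \<delta>(1)] by blast
          define Z where "Z = {y \<in> E. \<forall>s. 0 < s \<longrightarrow> s \<le> r \<longrightarrow> \<not> dense N (\<Lambda> * l) y s}"
          have 1: "Z \<subseteq> X" using E qball_subset_space by (auto simp: Z_def)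
          have 2: "nbhd Z U" using U(1) by (auto simp: nbhd_def Z_def)
          have 3: "\<And>y s. y \<in> Z \<Longrightarrow> 0 < s \<Longrightarrow> s \<le> r \<Longrightarrow> \<not> dense N (\<Lambda> * l) y s"
            by (auto simp: Z_def)
          have 4: "0 \<le> \<Lambda> * l" using \<Lambda> l by simp
          obtain V where V: "V \<in> sets \<mu>" "Z \<subseteq> V"
            "emeasure N V \<le> ennreal (k * (\<Lambda> * l)) * emeasure \<mu> U"
            using cover_low_density[OF sets 1 r 2 4 3] unfolding k_def by blast
          \<comment> \<open>The split is along the measurable cover \<open>V\<close>, since
            \<open>Z\<close> itself may fail to be measurable.\<close>
          have "emeasure N E \<le> emeasure N ((E - V) \<union> V)"
            using E V sets by (intro emeasure_mono) auto
          also have "\<dots> \<le> emeasure N (E - V) + emeasure N V"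
            using E V sets by (intro emeasure_subadditive) auto
          also have "emeasure N (E - V) \<le> ennreal ((1/2) ^ n) * emeasure N (Q x (\<tau> * r))"
          proof (rule decay[OF x r l _ _ vb])
            fix y assume "y \<in> E - V"
            then have "\<not> (\<forall>s. 0 < s \<longrightarrow> s \<le> r \<longrightarrow> \<not> dense N (\<Lambda> * l) y s)"
              using V(2) by (auto simp: Z_def)
            then show "\<exists>s. 0 < s \<and> s \<le> r \<and> dense N ((2 ^ a) ^ n * l) y s" by (auto simp: \<Lambda>_def)
          qed (use E V in auto)
          also have "\<dots> = ennreal ((1/2) ^ n * v)" using real v by (simp add: ennreal_mult)
          also have "emeasure N V \<le> ennreal (k * (\<Lambda> * l)) * (ennreal m + ennreal \<delta>)"
            using V(3) U(2) m(2) by (metis mult_left_mono order_trans zero_le)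
          also have "\<dots> = ennreal (k * (\<Lambda> * l) * (m + \<delta>))"
            using m \<delta> kl by (simp add: ennreal_plus[symmetric] ennreal_mult[symmetric] del: ennreal_plus)
          finally have "ennreal e \<le> ennreal ((1/2) ^ n * v) + ennreal (k * (\<Lambda> * l) * (m + \<delta>))"
            using e(2) by (simp add: add_left_mono)
          also have "\<dots> = ennreal ((1/2) ^ n * v + k * (\<Lambda> * l) * (m + \<delta>))"
            using v m \<delta> kl by (intro ennreal_plus[symmetric]) auto
          finally have "e \<le> (1/2) ^ n * v + k * (\<Lambda> * l) * (m + \<delta>)"
            using v m \<delta> kl by (subst (asm) ennreal_le_iff) auto
          then show ?thesis using \<delta>(2) by (simp add: distrib_left)
        qed
        then have "e \<le> (1/2) ^ n * v + k * (\<Lambda> * l) * m" by (rule field_le_epsilon)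
        also have "\<dots> = ((1/2) ^ n + k * \<Lambda> * (m / b)) * v" by (simp add: l_def algebra_simps)
        finally have "ennreal e \<le> ennreal ((1/2) ^ n + k * \<Lambda> * (m / b)) * ennreal v"
          using fac v by (simp add: ennreal_mult[symmetric] ennreal_leI)
        then show ?thesis using e(2) real by (simp add: \<Lambda>_def m_def b_def)
      qed
    qed
  qed
  have final: "weight_of \<mu> w E \<le> ennreal ((2 + k) * (measure \<mu> E / measure \<mu> (Q x r)) powr (1 / (2 * real a)))
      * weight_of \<mu> w (Q x (2 * \<kappa> * \<sigma> * r))"
    if x: "x \<in> X" and r: "0 < r" and E: "E \<in> sets \<mu>" "E \<subseteq> Q x r" for x r E
  proof -
    define t where "t = measure \<mu> E / measure \<mu> (Q x r)"
    have b: "0 < measure \<mu> (Q x r)" using measure_qball_pos[OF x r] .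
    have fm: "E \<in> fmeasurable \<mu>" "Q x r \<in> fmeasurable \<mu>"
      using emeasure_subset_qball_finite[OF x E(2)] emeasure_subset_qball_finite[OF x order_refl] E x
      by (auto simp: fmeasurable_def)
    have "measure \<mu> E \<le> measure \<mu> (Q x r)"
      using measure_mono_fmeasurable[OF E(2,1) fm(2)] .
    then have t: "0 \<le> t" "t \<le> 1" using b by (auto simp: t_def)
    have "emeasure N E \<le> ennreal ((2 + k) * t powr (1 / (2 * real a))) * emeasure N (Q x (\<tau> * r))"
    proof (cases "t = 0")
      \<comment> \<open>The bound to be shown is 0 here and no single \<open>n\<close> gives it, but
        \<open>E\<close> is a null set.\<close>
      case True
      then have "measure \<mu> E = 0" using b by (simp add: t_def)
      moreover have "emeasure \<mu> E = ennreal (measure \<mu> E)"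
        using fm(1) by (intro emeasure_eq_ennreal_measure) (auto simp: fmeasurable_def)
      ultimately have "E \<in> null_sets \<mu>" using E by auto
      moreover have "absolutely_continuous \<mu> N"
        using w unfolding N_def wmeasure_def weight_def by (intro absolutely_continuousI_density) auto
      ultimately have "emeasure N E = 0" by (auto simp: absolutely_continuous_def)
      then show ?thesis by simp
    next
      case False
      then obtain n where n: "(1/2) ^ n + k * (2 ^ a) ^ n * t \<le> (2 + k) * t powr (1 / (2 * real a))"
        using dyadic_interpolation[OF a, of k t] t k by auto
      have "emeasure N E \<le> ennreal ((1/2) ^ n + k * (2 ^ a) ^ n * t) * emeasure N (Q x (\<tau> * r))"
        using bound[OF x r E] by (simp add: t_def)
      also have "\<dots> \<le> ennreal ((2 + k) * t powr (1 / (2 * real a))) * emeasure N (Q x (\<tau> * r))"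
        using n by (intro mult_right_mono ennreal_leI) auto
      finally show ?thesis .
    qed
    then show ?thesis using weight_of_eq[OF w] E x by (simp add: t_def N_def \<tau>_def)
  qed
  show "w \<in> script_A_inf X \<rho> \<mu> (2 * \<kappa> * \<sigma>)"
    unfolding script_A_inf_def
  proof (intro CollectI conjI exI ballI allI impI w)
    show "0 < 2 + k" "1 \<le> 2 * real a" using k a by auto
  qed (rule final)
qed

subsection \<open>Independence of the dilation factor\<close>

text \<open>The selected balls are disjoint and lie in \<open>Q x (2 * \<kappa> * r)\<close>, which
  is contained in \<open>Q y (3 * \<kappa>\<^sup>2 * r)\<close> for each centre \<open>y\<close>.
  Hence each carries at least the fraction \<open>1 / d\<close> of its measure, with
  \<open>d = dbl (3 * \<kappa>\<^sup>2 / \<delta>)\<close>, and there are at most \<open>d\<close>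
  of them.\<close>

lemma finite_qball_cover:
  assumes \<delta>: "0 < \<delta>" "\<delta> \<le> 1" and x: "x \<in> X" and r: "0 < r"
  obtains T where "finite T" "T \<subseteq> Q x r" "real (card T) \<le> dbl (3 * \<kappa>\<^sup>2 / \<delta>)"
    "Q x r \<subseteq> (\<Union>y\<in>T. Q y (7 * \<kappa>\<^sup>2 * (\<delta> * r)))"
    "\<forall>y\<in>T. measure \<mu> (Q x r) \<le> dbl (3 * \<kappa>\<^sup>2 / \<delta>) * measure \<mu> (Q y (\<delta> * r))"
proof -
  define d where "d = dbl (3 * \<kappa>\<^sup>2 / \<delta>)"
  have d: "1 \<le> d" by (simp add: d_def dbl_ge_1)
  have dr: "0 < \<delta> * r" "\<delta> * r \<le> r" using \<delta> r by (simp_all add: mult_left_le_one_le)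
  define F where "F = Q x r \<times> {\<delta> * r}"
  have F: "\<And>p. p \<in> F \<Longrightarrow> fst p \<in> X \<and> 0 < snd p \<and> snd p \<le> r"
    using dr by (auto simp: F_def qball_def)
  obtain J where J: "J \<subseteq> F" "countable J" "disjoint_family_on QQ J"
    "\<forall>p\<in>F. \<exists>q\<in>J. snd p \<le> 2 * snd q \<and> Q (fst p) (2 * snd p) \<subseteq> Q (fst q) (7 * \<kappa>\<^sup>2 * snd q)"
    using Vitali_qballs[OF F] by blast
  have JF: "fst p \<in> X" "fst p \<in> Q x r" "snd p = \<delta> * r" if "p \<in> J" for p
    using J(1) that by (auto simp: F_def qball_def)
  define B where "B = Q x (2 * \<kappa> * r)"
  have sub: "QQ p \<subseteq> B" if p: "p \<in> J" for p
  proof -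
    have "\<kappa> * (r + \<delta> * r) \<le> \<kappa> * (2 * r)" using dr \<kappa>_ge_1 by (intro mult_left_mono) auto
    then show ?thesis using qball_subset[OF x JF(2)[OF p]] JF(3)[OF p] unfolding B_def by simp
  qed
  have fmB: "B \<in> fmeasurable \<mu>"
    using emeasure_subset_qball_finite[OF x, of B] x by (auto simp: B_def fmeasurable_def)
  have Bpos: "0 < measure \<mu> B" using measure_qball_pos[OF x] r \<kappa>_ge_1 by (simp add: B_def)
  have big: "measure \<mu> B \<le> d * measure \<mu> (Q y (\<delta> * r))" if y: "y \<in> Q x r" for y
  proof -
    have yX: "y \<in> X" using y qball_subset_space by auto
    have "1 * r \<le> \<kappa> * r" using r \<kappa>_ge_1 by (intro mult_right_mono) auto
    then have "\<kappa> * (r + 2 * \<kappa> * r) \<le> \<kappa> * (3 * (\<kappa> * r))"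
      using \<kappa>_ge_1 by (intro mult_left_mono) auto
    then have "B \<subseteq> Q y (3 * \<kappa>\<^sup>2 * r)"
      unfolding B_def using in_qball_commute[OF x y]
      by (intro qball_subset[OF yX, of x r]) (auto simp: power2_eq_square mult_ac)
    then have "emeasure \<mu> B \<le> emeasure \<mu> (Q y (3 * \<kappa>\<^sup>2 * r))" using yX by (intro emeasure_mono) auto
    also have "\<dots> \<le> ennreal d * emeasure \<mu> (Q y (\<delta> * r))"
      unfolding d_def using \<delta> dr by (intro emeasure_qball_le_dbl yX) auto
    finally show ?thesis
      using emeasure_qball_eq[OF x] emeasure_qball_eq[OF yX] d
      by (simp add: B_def ennreal_mult[symmetric])
  qed
  have bound: "real (card T) \<le> d" if T: "finite T" "T \<subseteq> J" for T
  proof -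
    have "real (card T) * (measure \<mu> B / d) = (\<Sum>p\<in>T. measure \<mu> B / d)" by simp
    also have "\<dots> \<le> (\<Sum>p\<in>T. measure \<mu> (QQ p))"
    proof (rule sum_mono)
      fix p assume "p \<in> T"
      then have "p \<in> J" using T by auto
      then show "measure \<mu> B / d \<le> measure \<mu> (QQ p)"
        using big[OF JF(2)] JF(3) d by (simp add: field_simps)
    qed
    also have "\<dots> = measure \<mu> (\<Union>p\<in>T. QQ p)"
    proof (rule measure_finite_Union[symmetric])
      show "QQ ` T \<subseteq> sets \<mu>" using T JF(1) by auto
      show "disjoint_family_on QQ T" using J(3) T(2) by (rule disjoint_family_on_mono[rotated])
      show "emeasure \<mu> (QQ p) \<noteq> \<infinity>" if "p \<in> T" for p
      proof -
        have "p \<in> J" using that T(2) by blast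
        then have "fst p \<in> X" by (rule JF(1))
        then show ?thesis by (simp add: emeasure_qball_eq)
      qed
    qed (rule T)
    also have "\<dots> \<le> measure \<mu> B"
      using T sub JF(1) fmB by (intro measure_mono_fmeasurable sets.finite_UN) auto
    finally show ?thesis using Bpos d by (simp add: field_simps)
  qed
  have fin: "finite J"
  proof (rule ccontr)
    assume "infinite J"
    obtain n :: nat where n: "d < n" using reals_Archimedean2 by blast
    obtain T where "T \<subseteq> J" "finite T" "card T = n"
      using infinite_arbitrarily_large[OF \<open>infinite J\<close>] by blast
    then show False using bound n by force
  qed
  show ?thesis
  proof (rule that[of "fst ` J"])
    show "finite (fst ` J)" "fst ` J \<subseteq> Q x r" using fin JF(2) by auto
    have "real (card (fst ` J)) \<le> real (card J)" using card_image_le[OF fin] by simp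
    then show "real (card (fst ` J)) \<le> dbl (3 * \<kappa>\<^sup>2 / \<delta>)" using bound[OF fin] by (simp add: d_def)
    show "Q x r \<subseteq> (\<Union>y\<in>fst ` J. Q y (7 * \<kappa>\<^sup>2 * (\<delta> * r)))"
    proof
      fix y assume y: "y \<in> Q x r"
      then have "(y, \<delta> * r) \<in> F" by (simp add: F_def)
      then obtain q where q: "q \<in> J" "Q y (2 * (\<delta> * r)) \<subseteq> Q (fst q) (7 * \<kappa>\<^sup>2 * snd q)"
        using J(4) by fastforce
      moreover have "y \<in> Q y (2 * (\<delta> * r))"
        using y qball_subset_space dr by (intro centre_in_qball) auto
      ultimately show "y \<in> (\<Union>y\<in>fst ` J. Q y (7 * \<kappa>\<^sup>2 * (\<delta> * r)))" using JF(3)[OF q(1)] by auto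
    qed
    show "\<forall>y\<in>fst ` J. measure \<mu> (Q x r) \<le> dbl (3 * \<kappa>\<^sup>2 / \<delta>) * measure \<mu> (Q y (\<delta> * r))"
    proof
      fix y assume "y \<in> fst ` J"
      then have y: "y \<in> Q x r" using JF(2) by auto
      have "Q x r \<subseteq> B" unfolding B_def using r \<kappa>_ge_1 by (intro qball_mono) (simp add: mult_ge1_I)
      then have "measure \<mu> (Q x r) \<le> measure \<mu> B" using x fmB by (intro measure_mono_fmeasurable) auto
      then show "measure \<mu> (Q x r) \<le> dbl (3 * \<kappa>\<^sup>2 / \<delta>) * measure \<mu> (Q y (\<delta> * r))"
        using big[OF y] by (simp add: d_def)
    qed
  qed
qed

text \<open>The power condition is applied to the traces of \<open>E\<close> on finitely many small
  balls that cover \<open>Q x r\<close>. However large \<open>\<sigma>\<close> is, their dilates by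
  \<open>\<sigma>\<close> fit into \<open>Q x (\<sigma>' * r)\<close> once the balls are small
  enough.\<close>

lemma script_A_inf_subset:
  assumes \<sigma>: "0 < \<sigma>" and \<sigma>': "\<kappa> < \<sigma>'"
  shows "script_A_inf X \<rho> \<mu> \<sigma> \<subseteq> script_A_inf X \<rho> \<mu> \<sigma>'"
proof
  fix w assume "w \<in> script_A_inf X \<rho> \<mu> \<sigma>"
  then obtain C p where w: "weight X \<mu> w" and C: "0 < C" and p: "1 \<le> p"
    and H: "\<And>x r E. x \<in> X \<Longrightarrow> 0 < r \<Longrightarrow> E \<in> sets \<mu> \<Longrightarrow> E \<subseteq> Q x r \<Longrightarrow>
      weight_of \<mu> w E \<le> ennreal (C * (measure \<mu> E / measure \<mu> (Q x r)) powr (1 / p))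
          * weight_of \<mu> w (Q x (\<sigma> * r))"
    unfolding script_A_inf_def by blast
  define N where "N = wmeasure w"
  have sets: "sets N = sets \<mu>" by (simp add: N_def)
  define K where "K = 7 * \<kappa>\<^sup>2"
  have "1 \<le> \<kappa>\<^sup>2" using \<kappa>_ge_1 by (simp add: one_le_power)
  then have K: "1 \<le> K" unfolding K_def by linarith
  \<comment> \<open>The covering balls have radius \<open>K * (\<delta> * r)\<close>. The second
    entry solves \<open>\<kappa> * (1 + \<delta> * (\<sigma> * K)) = \<sigma>'\<close> and is
    positive because \<open>\<kappa> < \<sigma>'\<close>.\<close>
  define \<delta> where "\<delta> = min 1 ((\<sigma>' / \<kappa> - 1) / (\<sigma> * K))"
  have "1 < \<sigma>' / \<kappa>" using \<sigma>' \<kappa>_ge_1 by (simp add: field_simps)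
  then have \<delta>: "0 < \<delta>" "\<delta> \<le> 1" using \<sigma> K by (auto simp: \<delta>_def)
  have "\<delta> * (\<sigma> * K) \<le> (\<sigma>' / \<kappa> - 1) / (\<sigma> * K) * (\<sigma> * K)"
    using \<sigma> K by (intro mult_right_mono) (auto simp: \<delta>_def)
  also have "\<dots> = \<sigma>' / \<kappa> - 1" using \<sigma> K by simp
  finally have "\<kappa> * (1 + \<delta> * (\<sigma> * K)) \<le> \<kappa> * (\<sigma>' / \<kappa>)" using \<kappa>_ge_1 by (intro mult_left_mono) auto
  then have dil: "\<kappa> * (1 + \<delta> * (\<sigma> * K)) \<le> \<sigma>'" using \<kappa>_ge_1 by simp
  define d where "d = dbl (3 * \<kappa>\<^sup>2 / \<delta>)"
  have d: "1 \<le> d" by (simp add: d_def dbl_ge_1)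
  \<comment> \<open>The first \<open>d\<close> bounds the number of covering balls, the second the
    measure of \<open>Q x r\<close> relative to one of them.\<close>
  define C' where "C' = d * (C * d powr (1 / p))"
  have C': "0 < C'" using C d by (simp add: C'_def)
  have final: "weight_of \<mu> w E \<le> ennreal (C' * (measure \<mu> E / measure \<mu> (Q x r)) powr (1 / p))
          * weight_of \<mu> w (Q x (\<sigma>' * r))"
    if x: "x \<in> X" and r: "0 < r" and E: "E \<in> sets \<mu>" "E \<subseteq> Q x r" for x r E
  proof -
    obtain T where T: "finite T" "T \<subseteq> Q x r" "real (card T) \<le> d"
      "Q x r \<subseteq> (\<Union>y\<in>T. Q y (K * (\<delta> * r)))"
      "\<forall>y\<in>T. measure \<mu> (Q x r) \<le> d * measure \<mu> (Q y (\<delta> * r))"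
      by (rule finite_qball_cover[OF \<delta> x r, folded d_def K_def])
    have TX: "T \<subseteq> X" using T(2) qball_subset_space by blast
    define t where "t = measure \<mu> E / measure \<mu> (Q x r)"
    have b: "0 < measure \<mu> (Q x r)" using measure_qball_pos[OF x r] .
    have fmE: "E \<in> fmeasurable \<mu>"
      using emeasure_subset_qball_finite[OF x E(2)] E by (auto simp: fmeasurable_def)
    define W where "W = emeasure N (Q x (\<sigma>' * r))"
    define g where "g = C * (d powr (1 / p) * t powr (1 / p))"
    have g: "0 \<le> g" using C by (simp add: g_def)
    have each: "emeasure N (E \<inter> Q y (K * (\<delta> * r))) \<le> ennreal g * W" if y: "y \<in> T" for y
    proof -
      define u where "u = K * (\<delta> * r)"
      have yB: "y \<in> Q x r" "y \<in> X" using y T(2) qball_subset_space by auto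
      have u: "0 < u" "\<delta> * r \<le> u" using K \<delta> r by (auto simp: u_def)
      have Em: "E \<inter> Q y u \<in> sets \<mu>" using E yB by auto
      have mu: "0 < measure \<mu> (Q y u)" using measure_qball_pos[OF yB(2) u(1)] .
      have fmy: "Q y u \<in> fmeasurable \<mu>"
        using emeasure_subset_qball_finite[OF yB(2), of "Q y u"] yB by (auto simp: fmeasurable_def)
      have "measure \<mu> (Q y (\<delta> * r)) \<le> measure \<mu> (Q y u)"
        using qball_mono[OF u(2)] yB fmy by (intro measure_mono_fmeasurable) auto
      then have "d * measure \<mu> (Q y (\<delta> * r)) \<le> d * measure \<mu> (Q y u)"
        using d by (intro mult_left_mono) auto
      then have rat: "measure \<mu> (Q x r) \<le> d * measure \<mu> (Q y u)" using bspec[OF T(5) y] by linarith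
      have "measure \<mu> (E \<inter> Q y u) / measure \<mu> (Q y u) \<le> measure \<mu> E / measure \<mu> (Q y u)"
        using Em fmE mu by (intro divide_right_mono measure_mono_fmeasurable) auto
      also have "\<dots> = measure \<mu> E * (1 / measure \<mu> (Q y u))" by simp
      also have "\<dots> \<le> measure \<mu> E * (d / measure \<mu> (Q x r))"
        using rat mu b by (intro mult_left_mono) (auto simp: field_simps)
      also have "\<dots> = d * t" by (simp add: t_def)
      finally have le: "(measure \<mu> (E \<inter> Q y u) / measure \<mu> (Q y u)) powr (1 / p) \<le> (d * t) powr (1 / p)"
        using p by (intro powr_mono2) auto
      then have pw: "C * (measure \<mu> (E \<inter> Q y u) / measure \<mu> (Q y u)) powr (1 / p) \<le> g"
      proof -
        have "0 \<le> t" using b by (simp add: t_def)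
        then have "(d * t) powr (1 / p) = d powr (1 / p) * t powr (1 / p)" using d by (simp add: powr_mult)
        then show ?thesis using C le by (simp add: g_def)
      qed
      have "emeasure N (E \<inter> Q y u) \<le> ennreal (C * (measure \<mu> (E \<inter> Q y u) / measure \<mu> (Q y u)) powr (1 / p))
          * emeasure N (Q y (\<sigma> * u))"
        using H[OF yB(2) u(1) Em] weight_of_eq[OF w] Em yB by (simp add: N_def)
      also have "\<dots> \<le> ennreal g * W"
        unfolding W_def
      proof (intro mult_mono ennreal_leI pw emeasure_mono)
        have "\<kappa> * (r + \<sigma> * u) = \<kappa> * (1 + \<delta> * (\<sigma> * K)) * r" by (simp add: u_def algebra_simps)
        also have "\<dots> \<le> \<sigma>' * r" using dil r by (intro mult_right_mono) auto
        finally show "Q y (\<sigma> * u) \<subseteq> Q x (\<sigma>' * r)" using qball_subset[OF x yB(1)] by blast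
      qed (use x sets in auto)
      finally show ?thesis by (simp add: u_def)
    qed
    have "emeasure N E \<le> emeasure N (\<Union>y\<in>T. E \<inter> Q y (K * (\<delta> * r)))"
      using E T TX sets by (intro emeasure_mono sets.finite_UN) auto
    also have "\<dots> \<le> (\<Sum>y\<in>T. emeasure N (E \<inter> Q y (K * (\<delta> * r))))"
      using E T(1) TX sets by (intro emeasure_subadditive_finite) auto
    also have "\<dots> \<le> (\<Sum>y\<in>T. ennreal g * W)" by (intro sum_mono each)
    also have "\<dots> = ennreal (real (card T)) * (ennreal g * W)" by (simp add: ennreal_of_nat_eq_real_of_nat)
    also have "\<dots> \<le> ennreal d * (ennreal g * W)" using T(3) by (intro mult_right_mono ennreal_leI) auto
    also have "\<dots> = ennreal (C' * t powr (1 / p)) * W"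
      using d g by (simp add: C'_def g_def ennreal_mult[symmetric] mult.assoc[symmetric])
    finally show ?thesis using weight_of_eq[OF w] E x by (simp add: N_def W_def t_def)
  qed
  show "w \<in> script_A_inf X \<rho> \<mu> \<sigma>'"
    unfolding script_A_inf_def
  proof (intro CollectI conjI exI ballI allI impI w)
    show "0 < C'" "1 \<le> p" using C' p by auto
  qed (rule final)
qed

end

subsection \<open>The weak type estimate\<close>

text \<open>Rests on \<open>L + (\<Sum>k<n. 2 ^ k * L) = 2 ^ n * L\<close>: if the right side were
  below \<open>m\<close>, induction would put \<open>y\<close> into every \<open>V k\<close> and
  make it infinite. The set \<open>V k\<close> only has to contain the level set, so it can be a
  measurable majorant.\<close>

lemma ennreal_le_dyadic_sum:
  fixes m :: ennreal and L :: real
  assumes L: "0 < L" and V: "\<And>k. ennreal (2 ^ k * L) < m \<Longrightarrow> y \<in> V k"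
  shows "m \<le> ennreal L + (\<Sum>k. ennreal (2 ^ k * L) * indicator (V k) y)"
    (is "m \<le> ?T")
proof (rule ccontr)
  assume "\<not> m \<le> ?T"
  then have T: "?T < m" by simp
  have pow: "ennreal (2 ^ n * L) \<le> ?T" for n
  proof (induction n rule: less_induct)
    case (less n)
    have "y \<in> V k" if "k < n" for k using V[of k] less.IH[OF that] T by simp
    then have "(\<Sum>k<n. ennreal (2 ^ k * L) * indicator (V k) y) = (\<Sum>k<n. ennreal (2 ^ k * L))"
      by (intro sum.cong) auto
    also have "\<dots> = ennreal (\<Sum>k<n. 2 ^ k * L)" using L by (intro sum_ennreal) auto
    finally have "ennreal L + (\<Sum>k<n. ennreal (2 ^ k * L) * indicator (V k) y) = ennreal (L + (\<Sum>k<n. 2 ^ k * L))"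
      using L by (simp add: ennreal_plus sum_nonneg)
    also have "L + (\<Sum>k<n. 2 ^ k * L) = 2 ^ n * L" by (induction n) (auto simp: algebra_simps)
    finally have "ennreal (2 ^ n * L) = ennreal L + (\<Sum>k<n. ennreal (2 ^ k * L) * indicator (V k) y)" ..
    also have "\<dots> \<le> ?T" by (intro add_left_mono sum_le_suminf) auto
    finally show ?case .
  qed
  obtain t where t: "?T = ennreal t" "0 \<le> t" using T by (cases ?T) (auto simp: not_less top_greatest)
  obtain n where "t / L < 2 ^ n" using real_arch_pow[of 2] by force
  then have "t < 2 ^ n * L" using L by (simp add: field_simps)
  then show False using pow[of n] t by (simp add: ennreal_le_iff)
qed

context homogeneous_type_space
begin

lemma wmeasure_le:
  assumes "weight X \<mu> w" "A \<in> sets \<mu>" "\<And>y. y \<in> A \<Longrightarrow> w y \<le> c"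
  shows "emeasure (wmeasure w) A \<le> ennreal c * emeasure \<mu> A"
proof -
  have "(\<integral>\<^sup>+y\<in>A. ennreal (w y) \<partial>\<mu>) \<le> (\<integral>\<^sup>+y. ennreal c * indicator A y \<partial>\<mu>)"
    using assms by (intro nn_integral_mono) (auto intro: ennreal_leI split: split_indicator)
  then show ?thesis
    using weight_of_eq[OF assms(1,2)] assms(2) by (simp add: weight_of_def nn_integral_cmult_indicator)
qed

lemma wmeasure_ge:
  assumes "weight X \<mu> w" "A \<in> sets \<mu>" "\<And>y. y \<in> A \<Longrightarrow> c \<le> w y"
  shows "ennreal c * emeasure \<mu> A \<le> emeasure (wmeasure w) A"
proof -
  have "(\<integral>\<^sup>+y. ennreal c * indicator A y \<partial>\<mu>) \<le> (\<integral>\<^sup>+y\<in>A. ennreal (w y) \<partial>\<mu>)"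
    using assms by (intro nn_integral_mono) (auto intro: ennreal_leI split: split_indicator)
  then show ?thesis
    using weight_of_eq[OF assms(1,2)] assms(2) by (simp add: weight_of_def nn_integral_cmult_indicator)
qed

text \<open>The part of a ball where \<open>w \<le> q\<close> contributes at most \<open>q\<close>
  to the average, so at least half of the bound \<open>2 * q\<close> comes from
  \<open>{y \<in> B. q < w y}\<close>, whose weight the disjoint Vitali balls share. The measurable
  \<open>V\<close> stands in for the union of the balls of \<open>F\<close>, which may not be
  measurable.\<close>

lemma weak_type:
  assumes w: "weight X \<mu> w" and B: "B \<in> sets \<mu>" and q: "0 < q"
    and F: "\<And>p. p \<in> F \<Longrightarrow> fst p \<in> X \<and> 0 < snd p \<and> snd p \<le> R \<and>
      ennreal (2 * q) * emeasure \<mu> (QQ p) \<le> emeasure (wmeasure w) (QQ p \<inter> B)"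
  obtains V where "V \<in> sets \<mu>" "\<forall>p\<in>F. QQ p \<subseteq> V"
    "ennreal q * emeasure \<mu> V \<le> ennreal (dbl (7 * \<kappa>\<^sup>2)) * emeasure (wmeasure w) {y \<in> B. q < w y}"
proof -
  define N where "N = wmeasure w"
  have sets: "sets N = sets \<mu>" by (simp add: N_def)
  define K where "K = 7 * \<kappa>\<^sup>2"
  have F': "\<And>p. p \<in> F \<Longrightarrow> fst p \<in> X \<and> 0 < snd p \<and> snd p \<le> R" using F by blast
  obtain J where J: "J \<subseteq> F" "countable J" "disjoint_family_on QQ J"
    "\<forall>p\<in>F. \<exists>q\<in>J. snd p \<le> 2 * snd q \<and> Q (fst p) (2 * snd p) \<subseteq> Q (fst q) (7 * \<kappa>\<^sup>2 * snd q)"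
    using Vitali_qballs[OF F'] by blast
  define V where "V = (\<Union>p\<in>J. Q (fst p) (K * snd p))"
  have V: "V \<in> sets \<mu>" unfolding V_def using J F' by (intro sets.countable_UN') auto
  have "QQ p \<subseteq> V" if p: "p \<in> F" for p
  proof -
    obtain q where "q \<in> J" "Q (fst p) (2 * snd p) \<subseteq> Q (fst q) (K * snd q)"
      using J(4) p unfolding K_def by blast
    moreover have "QQ p \<subseteq> Q (fst p) (2 * snd p)" using F'[OF p] by (intro qball_mono) simp
    ultimately show ?thesis unfolding V_def by blast
  qed
  moreover have "ennreal q * emeasure \<mu> V \<le> ennreal (dbl K) * emeasure N {y \<in> B. q < w y}"
  proof -
    define S where "S = {y \<in> B. q < w y}"
    have wm: "w \<in> borel_measurable \<mu>" using w by (simp add: weight_def)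
    have "{y \<in> space \<mu>. q < w y} \<in> sets \<mu>" using wm by measurable
    moreover have "S = B \<inter> {y \<in> space \<mu>. q < w y}"
      using sets.sets_into_space[OF B] by (auto simp: S_def)
    ultimately have S: "S \<in> sets \<mu>" using B by auto
    have trunc: "ennreal q * emeasure \<mu> (QQ p) \<le> emeasure N (QQ p \<inter> S)" if p: "p \<in> F" for p
    proof -
      have Qm: "QQ p \<in> sets \<mu>" using F'[OF p] by simp
      have fin: "ennreal q * emeasure \<mu> (QQ p) \<noteq> \<infinity>"
        using F'[OF p] q by (simp add: emeasure_qball_eq ennreal_mult[symmetric])
      have "ennreal q * emeasure \<mu> (QQ p) + ennreal q * emeasure \<mu> (QQ p) = ennreal (2 * q) * emeasure \<mu> (QQ p)"
        using q by (simp add: distrib_right[symmetric] ennreal_plus[symmetric] del: ennreal_plus)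
      also have "\<dots> \<le> emeasure N (QQ p \<inter> B)" using F[OF p] by (simp add: N_def)
      also have "\<dots> = emeasure N ((QQ p \<inter> B - S) \<union> (QQ p \<inter> S))"
        by (rule arg_cong[where f = "emeasure N"]) (auto simp: S_def)
      also have "\<dots> \<le> emeasure N (QQ p \<inter> B - S) + emeasure N (QQ p \<inter> S)"
        using Qm S B sets by (intro emeasure_subadditive) auto
      also have "emeasure N (QQ p \<inter> B - S) \<le> ennreal q * emeasure \<mu> (QQ p \<inter> B - S)"
        unfolding N_def using Qm S B by (intro wmeasure_le[OF w]) (auto simp: S_def)
      also have "\<dots> \<le> ennreal q * emeasure \<mu> (QQ p)"
        using Qm by (intro mult_left_mono emeasure_mono) auto
      finally have "ennreal q * emeasure \<mu> (QQ p) + ennreal q * emeasure \<mu> (QQ p)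
          \<le> ennreal q * emeasure \<mu> (QQ p) + emeasure N (QQ p \<inter> S)"
        by (simp add: add_right_mono)
      then show ?thesis using fin by (simp only: ennreal_add_left_cancel_le) simp
    qed
    have "emeasure \<mu> V \<le> ennreal (dbl K / q) * emeasure N (\<Union>p\<in>J. QQ p \<inter> S)"
    proof (rule emeasure_cover_le_disjoint[OF J(2) sets[symmetric], where F = "\<lambda>p. Q (fst p) (K * snd p)"])
      show "disjoint_family_on (\<lambda>p. QQ p \<inter> S) J" using J(3) by (fastforce simp: disjoint_family_on_def)
      fix p assume "p \<in> J"
      then have p: "p \<in> F" using J(1) by auto
      show "QQ p \<inter> S \<in> sets N" "Q (fst p) (K * snd p) \<in> sets N" using F'[OF p] S sets by auto
      have "emeasure \<mu> (Q (fst p) (K * snd p)) \<le> ennreal (dbl K) * emeasure \<mu> (QQ p)"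
        using F'[OF p] by (intro emeasure_qball_le_dbl) auto
      also have "ennreal (dbl K) = ennreal (dbl K / q) * ennreal q"
        using q dbl_ge_1[of K] by (subst ennreal_mult[symmetric]) auto
      also have "\<dots> * emeasure \<mu> (QQ p) \<le> ennreal (dbl K / q) * emeasure N (QQ p \<inter> S)"
        unfolding mult.assoc by (intro mult_left_mono trunc[OF p]) auto
      finally show "emeasure \<mu> (Q (fst p) (K * snd p)) \<le> ennreal (dbl K / q) * emeasure N (QQ p \<inter> S)" .
    qed (simp add: V_def)
    also have "\<dots> \<le> ennreal (dbl K / q) * emeasure N S"
      using S sets by (intro mult_left_mono emeasure_mono) auto
    finally have "ennreal q * emeasure \<mu> V \<le> ennreal q * (ennreal (dbl K / q) * emeasure N S)"
      by (intro mult_left_mono) auto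
    also have "\<dots> = ennreal (dbl K) * emeasure N S"
      using q dbl_ge_1[of K] by (simp add: mult.assoc[symmetric] ennreal_mult[symmetric])
    finally show ?thesis by (simp add: S_def)
  qed
  ultimately show ?thesis using that V unfolding N_def K_def by blast
qed

lemma script_A_inf_subset_A_inf:
  assumes \<sigma>: "1 \<le> \<sigma>"
  shows "script_A_inf X \<rho> \<mu> \<sigma> \<subseteq> A_inf X \<rho> \<mu> \<sigma>"
proof
  fix w assume "w \<in> script_A_inf X \<rho> \<mu> \<sigma>"
  then obtain C p where w: "weight X \<mu> w" and C: "0 < C" and p: "1 \<le> p"
    and H: "\<And>x r E. x \<in> X \<Longrightarrow> 0 < r \<Longrightarrow> E \<in> sets \<mu> \<Longrightarrow> E \<subseteq> Q x r \<Longrightarrow>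
      weight_of \<mu> w E \<le> ennreal (C * (measure \<mu> E / measure \<mu> (Q x r)) powr (1 / p))
          * weight_of \<mu> w (Q x (\<sigma> * r))"
    unfolding script_A_inf_def by blast
  define N where "N = wmeasure w"
  have sets: "sets N = sets \<mu>" by (simp add: N_def)
  define c k where "c = dbl (2 * \<kappa>)" and "k = dbl (7 * \<kappa>\<^sup>2)"
  have c: "1 \<le> c" and k: "1 \<le> k" by (simp_all add: c_def k_def dbl_ge_1)
  \<comment> \<open>Halving the measure ratio multiplies the power bound by \<open>\<beta>\<close>,
    the ratio of the geometric series over the dyadic levels.\<close>
  define \<beta> where "\<beta> = (1 / 2) powr (1 / p)"
  have \<beta>: "0 < \<beta>" "\<beta> < 1" using p powr_less_mono2[of "1 / p" "1 / 2" 1] by (auto simp: \<beta>_def)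
  \<comment> \<open>The 2 relates \<open>2 ^ j * L\<close> to the truncation height
    \<open>q\<close>, \<open>k\<close> comes from \<open>weak_type\<close>, and
    \<open>2 powr (1 / p)\<close> from the bound \<open>2 * (1 / 2) ^ j\<close> for the measure
    ratio.\<close>
  define D0 where "D0 = 2 * k * C * 2 powr (1 / p)"
  have D0: "0 < D0" using k C by (simp add: D0_def)
  define C' where "C' = c + D0 / (1 - \<beta>)"
  have C': "0 < C'" using c D0 \<beta> by (simp add: C'_def add_pos_pos)
  have final: "(\<integral>\<^sup>+y\<in>Q x r. maximal X \<rho> \<mu> (\<lambda>z. indicator (Q x r) z * w z) y \<partial>\<mu>)
        \<le> ennreal C' * weight_of \<mu> w (Q x (\<sigma> * r))" if x: "x \<in> X" and r: "0 < r" for x r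
  proof -
    define B where "B = Q x r"
    have Bm: "B \<in> sets \<mu>" using x by (simp add: B_def)
    define M where "M = maximal X \<rho> \<mu> (\<lambda>z. indicator B z * w z)"
    have Msup: "M y = (SUP (z, s) \<in> {(z, s). z \<in> X \<and> 0 < s \<and> y \<in> Q z s}.
        emeasure N (Q z s \<inter> B) / emeasure \<mu> (Q z s))" for y
      unfolding M_def maximal_def N_def
      using nn_integral_abs_restrict[OF w _ Bm] by (intro SUP_cong) auto
    have "1 * r \<le> \<sigma> * r" using \<sigma> r by (intro mult_right_mono) auto
    then have NB: "emeasure N B \<le> emeasure N (Q x (\<sigma> * r))"
      unfolding B_def using x sets by (intro emeasure_mono qball_mono) auto
    have "(\<integral>\<^sup>+y. M y * indicator B y \<partial>\<mu>) \<le> ennreal C' * emeasure N (Q x (\<sigma> * r))"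
    proof (cases "emeasure N (Q x (\<sigma> * r))")
      case top
      then show ?thesis using C' by (simp add: ennreal_mult_top)
    next
      case (real v)
      show ?thesis
      proof (cases "v = 0")
        case True
        have "emeasure N (A \<inter> B) = 0" for A
          using emeasure_mono[of "A \<inter> B" B N] Bm NB real True sets by simp
        then have "M y = 0" for y by (auto simp: Msup intro!: SUP_eqI)
        then show ?thesis by simp
      next
        case False
        then have v: "0 < v" using real by simp
        define b where "b = measure \<mu> B"
        have b: "0 < b" "emeasure \<mu> B = ennreal b"
          using measure_qball_pos[OF x r] emeasure_qball_eq[OF x] by (simp_all add: b_def B_def)
        \<comment> \<open>By doubling, a ball that meets \<open>B\<close> and has radius above
          \<open>2 * \<kappa> * r\<close> gives \<open>indicator B z * w z\<close> an average of at
          most \<open>L\<close>. Above \<open>L\<close> only bounded radii occur, as Vitali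
          selection requires.\<close>
        define L where "L = c * (v / b)"
        have L: "0 < L" "v / b \<le> L"
          using c v b mult_right_mono[of 1 c "v / b"] by (simp_all add: L_def)
        define F where "F j = {p. fst p \<in> X \<and> 0 < snd p \<and> snd p \<le> 2 * \<kappa> * r \<and>
          ennreal (2 * (2 ^ j * L / 2)) * emeasure \<mu> (QQ p) \<le> emeasure N (QQ p \<inter> B)}" for j :: nat
        have F: "\<exists>p\<in>F j. y \<in> QQ p" if y: "y \<in> B" "ennreal (2 ^ j * L) < M y" for y j
        proof -
          obtain z s where z: "z \<in> X" "0 < s" "y \<in> Q z s"
            "ennreal (2 ^ j * L) < emeasure N (Q z s \<inter> B) / emeasure \<mu> (Q z s)"
            using y(2) unfolding Msup less_SUP_iff by auto
          have zm: "0 < measure \<mu> (Q z s)" "emeasure \<mu> (Q z s) = ennreal (measure \<mu> (Q z s))"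
            using measure_qball_pos[OF z(1,2)] emeasure_qball_eq[OF z(1)] by auto
          have lt: "ennreal (2 ^ j * L) * emeasure \<mu> (Q z s) < emeasure N (Q z s \<inter> B)"
          proof (rule ccontr)
            assume "\<not> ?thesis"
            then have "emeasure N (Q z s \<inter> B) / emeasure \<mu> (Q z s) \<le>
                ennreal (2 ^ j * L) * emeasure \<mu> (Q z s) / emeasure \<mu> (Q z s)"
              by (intro divide_right_mono_ennreal) simp
            also have "\<dots> = ennreal (2 ^ j * L)" using zm by (simp add: mult_divide_eq_ennreal)
            finally show False using z(4) by simp
          qed
          have "s \<le> 2 * \<kappa> * r"
          proof (rule ccontr)
            assume "\<not> s \<le> 2 * \<kappa> * r"
            then have s: "2 * \<kappa> * r < s" by simp
            have yX: "y \<in> X" using z(3) qball_subset_space by auto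
            have "B \<subseteq> Q y (2 * \<kappa> * r)"
              unfolding B_def using y(1) in_qball_commute[OF x, of y r]
              by (intro qball_subset[OF yX, of x r]) (auto simp: B_def)
            also have "\<dots> \<subseteq> Q z (2 * \<kappa> * s)"
            proof (rule qball_subset[OF z(1,3)])
              have "\<kappa> * (s + 2 * \<kappa> * r) \<le> \<kappa> * (2 * s)" using s \<kappa>_ge_1 by (intro mult_left_mono) auto
              then show "\<kappa> * (s + 2 * \<kappa> * r) \<le> 2 * \<kappa> * s" by simp
            qed
            finally have "emeasure \<mu> B \<le> emeasure \<mu> (Q z (2 * \<kappa> * s))"
              using z(1) by (intro emeasure_mono) auto
            also have "\<dots> \<le> ennreal c * emeasure \<mu> (Q z s)"
              unfolding c_def using z by (intro emeasure_qball_le_dbl) auto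
            finally have "b \<le> c * measure \<mu> (Q z s)"
              using b zm c by (simp add: ennreal_mult[symmetric])
            then have "v \<le> L * measure \<mu> (Q z s)"
              using b v c by (simp add: L_def field_simps)
            also have "\<dots> \<le> 2 ^ j * L * measure \<mu> (Q z s)"
              using L zm by (intro mult_right_mono) auto
            finally have "ennreal v \<le> ennreal (2 ^ j * L) * emeasure \<mu> (Q z s)"
              using zm L by (simp add: ennreal_mult[symmetric] ennreal_leI)
            moreover have "emeasure N (Q z s \<inter> B) \<le> ennreal v"
              using NB real emeasure_mono[of "Q z s \<inter> B" B N] Bm sets by auto
            ultimately show False using lt by simp
          qed
          then have "(z, s) \<in> F j" using z lt by (simp add: F_def)
          then show ?thesis using z(3) by force
        qed
        have "\<exists>V. V \<in> sets \<mu> \<and> (\<forall>p\<in>F j. QQ p \<subseteq> V) \<and>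
            ennreal (2 ^ j * L) * emeasure \<mu> V \<le> ennreal (D0 * v * \<beta> ^ j)" for j
        proof -
          define q where "q = 2 ^ j * L / 2"
          have q: "0 < q" using L by (simp add: q_def)
          define S where "S = {y \<in> B. q < w y}"
          have wm: "w \<in> borel_measurable \<mu>" using w by (simp add: weight_def)
          have "{y \<in> space \<mu>. q < w y} \<in> sets \<mu>" using wm by measurable
          moreover have "S = B \<inter> {y \<in> space \<mu>. q < w y}"
            using sets.sets_into_space[OF Bm] by (auto simp: S_def)
          ultimately have S: "S \<in> sets \<mu>" "S \<subseteq> B" using Bm by (auto simp: S_def)
          have F': "\<And>p. p \<in> F j \<Longrightarrow> fst p \<in> X \<and> 0 < snd p \<and> snd p \<le> 2 * \<kappa> * r \<and>
              ennreal (2 * q) * emeasure \<mu> (QQ p) \<le> emeasure (wmeasure w) (QQ p \<inter> B)"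
            by (simp add: F_def q_def N_def)
          obtain V where V: "V \<in> sets \<mu>" "\<forall>p\<in>F j. QQ p \<subseteq> V"
            "ennreal q * emeasure \<mu> V \<le> ennreal k * emeasure N S"
            by (rule weak_type[OF w Bm q F', folded S_def N_def k_def])
          have "emeasure \<mu> S = ennreal (measure \<mu> S)"
            using emeasure_subset_qball_finite[OF x, of S r] S(2)
            by (intro emeasure_eq_ennreal_measure) (auto simp: B_def)
          \<comment> \<open>Chebyshev's inequality; with \<open>v / b \<le> L\<close> it bounds the
            measure ratio of \<open>S\<close> to \<open>B\<close> by
            \<open>2 * (1 / 2) ^ j\<close>.\<close>
          moreover have "ennreal q * emeasure \<mu> S \<le> emeasure N S"
            unfolding N_def using S(1) by (intro wmeasure_ge[OF w]) (auto simp: S_def)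
          moreover have "emeasure N S \<le> ennreal v"
            using NB real emeasure_mono[of S B N] Bm S sets by auto
          ultimately have "ennreal (q * measure \<mu> S) \<le> ennreal v"
            using q by (simp add: ennreal_mult order_trans)
          then have "q * measure \<mu> S \<le> v" using v by simp
          then have "measure \<mu> S \<le> v / q" using q by (simp add: field_simps)
          then have "measure \<mu> S / b \<le> v / q / b" using b by (intro divide_right_mono) auto
          also have "\<dots> = v / b * (2 * (1 / 2) ^ j / L)" by (simp add: q_def power_divide)
          also have "\<dots> \<le> L * (2 * (1 / 2) ^ j / L)" using L by (intro mult_right_mono) auto
          also have "\<dots> = 2 * (1 / 2) ^ j" using L by simp
          finally have "(measure \<mu> S / b) powr (1 / p) \<le> (2 * (1 / 2) ^ j) powr (1 / p)"
            using p b by (intro powr_mono2) auto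
          also have "\<dots> = 2 powr (1 / p) * ((1 / 2) ^ j) powr (1 / p)" by (rule powr_mult)
          also have "((1 / 2) ^ j) powr (1 / p) = \<beta> ^ j"
          proof -
            have "((1 / 2) ^ j) powr (1 / p) = ((1 / 2) powr real j) powr (1 / p)"
              by (simp add: powr_realpow)
            also have "\<dots> = \<beta> powr real j" by (simp add: \<beta>_def powr_powr mult.commute)
            finally show ?thesis using \<beta> by (simp add: powr_realpow)
          qed
          finally have pw: "(measure \<mu> S / b) powr (1 / p) \<le> 2 powr (1 / p) * \<beta> ^ j" .
          have "emeasure N S \<le> ennreal (C * (measure \<mu> S / b) powr (1 / p)) * ennreal v"
            using H[OF x r S(1)] S(2) weight_of_eq[OF w] S(1) x real by (simp add: N_def B_def b_def)
          also have "\<dots> \<le> ennreal (C * (2 powr (1 / p) * \<beta> ^ j)) * ennreal v"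
            using C pw by (intro mult_right_mono ennreal_leI mult_left_mono) auto
          finally have NS: "emeasure N S \<le> ennreal (C * (2 powr (1 / p) * \<beta> ^ j)) * ennreal v" .
          have "ennreal (2 ^ j * L) * emeasure \<mu> V = ennreal 2 * (ennreal q * emeasure \<mu> V)"
            using q by (simp add: q_def mult.assoc[symmetric] ennreal_mult[symmetric] del: ennreal_numeral)
          also have "\<dots> \<le> ennreal 2 * (ennreal k * (ennreal (C * (2 powr (1 / p) * \<beta> ^ j)) * ennreal v))"
            by (intro mult_left_mono order_trans[OF V(3)] NS) auto
          also have "\<dots> = ennreal (D0 * v * \<beta> ^ j)"
            using k C v \<beta> by (simp add: D0_def ennreal_mult[symmetric] mult_ac del: ennreal_numeral)
          finally show ?thesis using V(1,2) by blast
        qed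
        then obtain V where V: "\<And>j. V j \<in> sets \<mu>" "\<And>j p. p \<in> F j \<Longrightarrow> QQ p \<subseteq> V j"
          "\<And>j. ennreal (2 ^ j * L) * emeasure \<mu> (V j) \<le> ennreal (D0 * v * \<beta> ^ j)"
          by metis
        \<comment> \<open>The right side is measurable, so its integral can be computed termwise,
          while \<open>M\<close> enters by monotonicity alone.\<close>
        have "M y * indicator B y \<le> ennreal L * indicator B y + (\<Sum>j. ennreal (2 ^ j * L) * indicator (V j) y)"
          for y
        proof (cases "y \<in> B")
          case True
          have "y \<in> V j" if "ennreal (2 ^ j * L) < M y" for j using F[OF True that] V(2) by blast
          then show ?thesis using ennreal_le_dyadic_sum[OF L(1), of "M y" y V] True by simp
        qed simp
        then have "(\<integral>\<^sup>+y. M y * indicator B y \<partial>\<mu>) \<le>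
            (\<integral>\<^sup>+y. ennreal L * indicator B y + (\<Sum>j. ennreal (2 ^ j * L) * indicator (V j) y) \<partial>\<mu>)"
          by (intro nn_integral_mono)
        also have "\<dots> = ennreal L * emeasure \<mu> B + (\<Sum>j. ennreal (2 ^ j * L) * emeasure \<mu> (V j))"
          using Bm V(1) by (simp add: nn_integral_add nn_integral_suminf nn_integral_cmult_indicator)
        also have "\<dots> \<le> ennreal L * ennreal b + (\<Sum>j. ennreal (D0 * v * \<beta> ^ j))"
          using b(2) by (intro add_mono suminf_le V(3)) auto
        also have "(\<Sum>j. ennreal (D0 * v * \<beta> ^ j)) = ennreal (D0 * v * (1 / (1 - \<beta>)))"
          using D0 v \<beta> by (intro suminf_ennreal_eq sums_mult geometric_sums) auto
        also have "ennreal L * ennreal b + \<dots> = ennreal (c * v + D0 * v * (1 / (1 - \<beta>)))"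
          using L(1) b(1) c D0 v \<beta> by (subst ennreal_plus) (auto simp: L_def ennreal_mult[symmetric])
        also have "\<dots> = ennreal C' * ennreal v"
          using C' v by (simp add: ennreal_mult[symmetric] C'_def algebra_simps)
        finally show ?thesis using real by simp
      qed
    qed
    then show ?thesis using weight_of_eq[OF w] x by (simp add: M_def B_def N_def)
  qed
  show "w \<in> A_inf X \<rho> \<mu> \<sigma>"
    unfolding A_inf_def
  proof (intro CollectI conjI exI ballI allI impI w)
    show "0 \<le> C'" using C' by simp
  qed (rule final)
qed

end

section \<open>Equality of the classes\<close>

theorem lemma8p2:
  fixes X :: "'a set" and \<rho> :: "'a \<Rightarrow> 'a \<Rightarrow> real" and \<mu> :: "'a measure"
    and \<kappa> D \<sigma> \<sigma>' :: real
  assumes "homogeneous_type_space X \<rho> \<kappa> \<mu> D"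
    and "\<sigma> > \<kappa>" and "\<sigma>' > \<kappa>"
  shows "script_A_inf X \<rho> \<mu> \<sigma> = A_inf X \<rho> \<mu> \<sigma> \<and> A_inf X \<rho> \<mu> \<sigma> = script_A_inf X \<rho> \<mu> \<sigma>'"
proof -
  interpret homogeneous_type_space X \<rho> \<kappa> \<mu> D by fact
  have \<sigma>: "1 \<le> \<sigma>" "1 \<le> \<sigma>'" using assms(2,3) \<kappa>_ge_1 by simp_all
  then have "0 < 2 * \<kappa> * \<sigma>" using \<kappa>_ge_1 by simp
  \<comment> \<open>The dilation \<open>2 * \<kappa> * \<sigma>\<close> reached from the maximal
    condition is exchanged for any \<open>s\<close> above \<open>\<kappa>\<close>; the cases
    \<open>s = \<sigma>\<close> and \<open>s = \<sigma>'\<close> are the ones needed.\<close>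
  then have A: "A_inf X \<rho> \<mu> \<sigma> \<subseteq> script_A_inf X \<rho> \<mu> s" if "\<kappa> < s" for s
    using A_inf_subset_script_A_inf[OF \<sigma>(1)] script_A_inf_subset[OF _ that] by blast
  have "script_A_inf X \<rho> \<mu> \<sigma>' \<subseteq> script_A_inf X \<rho> \<mu> \<sigma>"
    using \<sigma> assms(2) by (intro script_A_inf_subset) auto
  then show ?thesis
    using A[OF assms(2)] A[OF assms(3)] script_A_inf_subset_A_inf[OF \<sigma>(1)] by blast
qed

end
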